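(* Up to equivalence there is a unique cell system on $\mathcal{E}^{(24)}$, given by $$W_{1,9,17}=W_{8,16,24}=\sqrt{[2][3]},\qquad W_{2,9,17}=W_{7,16,24}=\sqrt{[3][4]},$$ $$W_{2,9,18}=W_{2,10,17}=W_{7,15,24}=W_{7,16,23}=[3]\sqrt{[4]},$$ $$W_{2,10,19}=W_{2,11,18}=W_{7,14,23}=W_{7,15,22}=\sqrt{[3][4][5]},$$ $$W_{2,11,19}=W_{7,14,22}=[3]\sqrt{[4][5]},$$ $$W_{3,10,19}=W_{3,14,23}=W_{6,11,18}=W_{6,15,22}=\frac{[4]\sqrt{[3][5]}}{\sqrt{[2]}},$$ $$W_{4,11,19}=W_{4,14,22}=W_{5,11,19}=W_{5,14,22}=\sqrt{[4][5][7]},$$ $$W_{4,12,19}=W_{4,14,21}=W_{5,11,20}=W_{5,13,22}=\frac{[3]\sqrt{[5][9]}}{\sqrt{[2]}},$$ $$W_{3,12,19}=W_{3,14,21}=W_{6,11,20}=W_{6,13,22}=\frac{\sqrt{[3][5][9]}}{\sqrt{[2]}},$$ $$W_{3,14,19}=W_{6,11,22}=\frac{[3][5]}{\sqrt{[2]}},\qquad W_{4,14,19}=W_{5,11,22}=\frac{[5]\sqrt{[7]}}{\sqrt{[2]}},$$ $$W_{5,14,19}=\sqrt{[5][7][10]},\qquad W_{4,11,22}=-\sqrt{[5][7][10]},$$ $$W_{3,12,21}=W_{6,13,20}=-\frac{[5]\sqrt{[9]}}{\sqrt{[2]}},\qquad W_{4,12,21}=W_{5,13,20}=\frac{\sqr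t{[7][9]}}{\sqrt{[2]}}.$$
   Context: Let $q=e^{\pi i/24}$ and $[m]=(q^m-q^{-m})/(q-q^{-1})$. The graph $\mathcal{E}^{(24)}$ has vertices $1,\ldots,24$ and exactly the following edges (one each): $1\to 9$; $2\to 9,10,11$; $3\to 10,12,14$; $4\to 11,12,14$; $5\to 11,13,14$; $6\to 11,13,15$; $7\to 14,15,16$; $8\to 16$; $9\to 17,18$; $10\to 17,19$; $11\to 18,19,20,22$; $12\to 19,21$; $13\to 20,22$; $14\to 19,21,22,23$; $15\to 22,24$; $16\to 23,24$; $17\to 1,2$; $18\to 2,6$; $19\to 2,3,4,5$; $20\to 5,6$; $21\to 3,4$; $22\to 4,5,6,7$; $23\to 3,7$; $24\to 7,8$. Its Perron-Frobenius eigenvector (eigenvalue $[3]$) is $\phi_1=\phi_8=1$, $\phi_2=\phi_7=[2][4]$, $\phi_3=\phi_6=[4][5]/[2]$, $\phi_4=\phi_5=[4][7]/[2]$, $\phi_9=\phi_{16}=\phi_{17}=\phi_{24}=[3]$, $\phi_{10}=\phi_{15}=\phi_{18}=\phi_{23}=[3][4]/[2]$, $\phi_{11}=\phi_{14}=\phi_{19}=\phi_{22}=[3][5]$, $\phi_{12}=\phi_{13}=\phi_{20}=\phi_{21}=[9]$. $W_{a,b,c}$ denotes the value of $W$ on the triangle $a\to b\to c\to a$. Cell systems: let $\mathcal{G}$ be a directed graph (loops and multiple edges allowed), with source and range maps $s,r$, Perron-Frobenius eigenvalue $[3]$ and positive Perron-Frobenius eigenvector $(\phi_i)$. A triangle $\triangle_{ijk}^{(\alpha\beta\gamma)}$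 is a closed path $i\xrightarrow{\alpha}j\xrightarrow{\beta}k\xrightarrow{\gamma}i$, considered up to cyclic rotation. A cell system $W$ assigns to each triangle a complex number $W(\triangle_{ijk}^{(\alpha\beta\gamma)})$ such that: (I) for all edges $\alpha,\alpha'$ from $i$ to $j$, $\sum_{k,\beta,\gamma}W(\triangle_{ijk}^{(\alpha\beta\gamma)})\overline{W(\triangle_{ijk}^{(\alpha'\beta\gamma)})}=\delta_{\alpha,\alpha'}[2]\phi_i\phi_j$, the sum being over vertices $k$ and edges $\beta:j\to k$, $\gamma:k\to i$; (II) for all edges $\alpha_1,\dots,\alpha_4$ with $s(\alpha_1)=s(\alpha_4)=i_1$, $r(\alpha_1)=r(\alpha_2)=i_2$, $s(\alpha_2)=s(\alpha_3)=i_3$, $r(\alpha_3)=r(\alpha_4)=i_4$, $$\sum\phi_k^{-1}W(\triangle_{i_1i_2k}^{(\alpha_1\beta_1\beta_2)})\overline{W(\triangle_{i_3i_2k}^{(\alpha_2\beta_1\beta_3)})}W(\triangle_{i_3i_4k}^{(\alpha_3\beta_4\beta_3)})\overline{W(\triangle_{i_1i_4k}^{(\alpha_4\beta_4\beta_2)})}=\delta_{\alpha_1,\alpha_4}\delta_{\alpha_2,\alpha_3}\phi_{i_1}\phi_{i_2}\phi_{i_3}+\delta_{\alpha_1,\alpha_2}\delta_{\alpha_3,\alpha_4}\phi_{i_1}\phi_{i_2}\phi_{i_4},$$ the sum being over vertices $k$ and edges $\beta_1:i_2\to k$, $\beta_2:k\to i_1$, $\beta_3:k\to i_3$, $\beta_4:i_4\to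 k$. Two cell systems $W_1,W_2$ on $\mathcal{G}$ are equivalent if for each pair of adjacent vertices $i,j$ there is a unitary matrix $(u(\sigma,\sigma'))$ indexed by the edges from $i$ to $j$ such that for every triangle $W_1(\triangle_{ijk}^{(\sigma\rho\gamma)})=\sum_{\sigma',\rho',\gamma'}u(\sigma,\sigma')u(\rho,\rho')u(\gamma,\gamma')W_2(\triangle_{ijk}^{(\sigma'\rho'\gamma')})$, summing over edges $\sigma':i\to j$, $\rho':j\to k$, $\gamma':k\to i$. *)

theory Defs
  imports Complex_Main "Graph_Theory.Digraph"
begin

section \<open>Quantum integers\<close>

definition q :: complex where
  "q = exp (\<i> * of_real pi / 24)"

text \<open>The quotient is real (see \<open>of_real_qint\<close>), so nothing is lost in taking the real part.\<close>

definition qint :: "nat \<Rightarrow> real" (\<open>\<lbrakk>_\<rbrakk>\<^sub>q\<close>) where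
  "\<lbrakk>m\<rbrakk>\<^sub>q = Re ((q ^ m - inverse q ^ m) / (q - inverse q))"

lemma of_real_qint: "complex_of_real \<lbrakk>m\<rbrakk>\<^sub>q = (q ^ m - inverse q ^ m) / (q - inverse q)"
proof -
  have "q = cis (pi / 24)"
    by (simp add: q_def cis_conv_exp)
  then have c: "cnj q = inverse q"
    by (metis cis_cnj cis_inverse)
  have "cnj ((q ^ m - inverse q ^ m) / (q - inverse q))
      = (inverse q ^ m - q ^ m) / (inverse q - q)"
    by (simp add: c)
  also have "\<dots> = (- (q ^ m - inverse q ^ m)) / (- (q - inverse q))"
    by simp
  also have "\<dots> = (q ^ m - inverse q ^ m) / (q - inverse q)"
    by (simp only: minus_divide_left [symmetric] minus_divide_right [symmetric] minus_minus)
  finally show ?thesis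
    unfolding qint_def by (metis Reals_cnj_iff of_real_Re)
qed


section \<open>Cell systems on directed graphs\<close>

definition arcs_between :: "('v, 'e) pre_digraph \<Rightarrow> 'v \<Rightarrow> 'v \<Rightarrow> 'e set" where
  "arcs_between G i j = {e \<in> arcs G. tail G e = i \<and> head G e = j}"

text \<open>A positive eigenvector of the adjacency matrix for its Perron-Frobenius eigenvalue
  \<open>\<theta>\<close>, that is, for an eigenvalue that bounds the modulus of every complex eigenvalue.\<close>

definition perron_frobenius_eigenvector ::
    "('v, 'e) pre_digraph \<Rightarrow> real \<Rightarrow> ('v \<Rightarrow> real) \<Rightarrow> bool" where
  "perron_frobenius_eigenvector G \<theta> \<phi> \<longleftrightarrow>
     (\<forall>i\<in>verts G. \<phi> i > 0) \<and>
     (\<forall>i\<in>verts G. (\<Sum>j\<in>verts G. of_nat (card (arcs_between G i j)) * \<phi> j) = \<theta> * \<phi> i) \<and>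
     (\<forall>(\<mu>::complex) (x :: 'v \<Rightarrow> complex).
        (\<exists>i\<in>verts G. x i \<noteq> 0) \<longrightarrow>
        (\<forall>i\<in>verts G. (\<Sum>j\<in>verts G. of_nat (card (arcs_between G i j)) * x j) = \<mu> * x i) \<longrightarrow>
        cmod \<mu> \<le> \<theta>)"

definition triangle :: "('v, 'e) pre_digraph \<Rightarrow> 'e \<Rightarrow> 'e \<Rightarrow> 'e \<Rightarrow> bool" where
  "triangle G \<alpha> \<beta> \<gamma> \<longleftrightarrow>
     \<alpha> \<in> arcs G \<and> \<beta> \<in> arcs G \<and> \<gamma> \<in> arcs G \<and>
     head G \<alpha> = tail G \<beta> \<and> head G \<beta> = tail G \<gamma> \<and> head G \<gamma> = tail G \<alpha>"

text \<open>A function on triangles up to rotation is encoded as a function of three edges that is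
  invariant under rotation of triangles; its values at other triples are irrelevant.\<close>

definition rotation_invariant ::
    "('v, 'e) pre_digraph \<Rightarrow> ('e \<Rightarrow> 'e \<Rightarrow> 'e \<Rightarrow> complex) \<Rightarrow> bool" where
  "rotation_invariant G W \<longleftrightarrow> (\<forall>\<alpha> \<beta> \<gamma>. triangle G \<alpha> \<beta> \<gamma> \<longrightarrow> W \<alpha> \<beta> \<gamma> = W \<beta> \<gamma> \<alpha>)"

definition type_I ::
    "('v, 'e) pre_digraph \<Rightarrow> ('v \<Rightarrow> real) \<Rightarrow> ('e \<Rightarrow> 'e \<Rightarrow> 'e \<Rightarrow> complex) \<Rightarrow> bool" where
  "type_I G \<phi> W \<longleftrightarrow>
     (\<forall>i\<in>verts G. \<forall>j\<in>verts G. \<forall>\<alpha>\<in>arcs_between G i j. \<forall>\<alpha>'\<in>arcs_between G i j.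
        (\<Sum>k\<in>verts G. \<Sum>\<beta>\<in>arcs_between G j k. \<Sum>\<gamma>\<in>arcs_between G k i.
            W \<alpha> \<beta> \<gamma> * cnj (W \<alpha>' \<beta> \<gamma>))
        = of_bool (\<alpha> = \<alpha>') * of_real (\<lbrakk>2\<rbrakk>\<^sub>q * \<phi> i * \<phi> j))"

definition type_II ::
    "('v, 'e) pre_digraph \<Rightarrow> ('v \<Rightarrow> real) \<Rightarrow> ('e \<Rightarrow> 'e \<Rightarrow> 'e \<Rightarrow> complex) \<Rightarrow> bool" where
  "type_II G \<phi> W \<longleftrightarrow>
     (\<forall>i\<^sub>1\<in>verts G. \<forall>i\<^sub>2\<in>verts G. \<forall>i\<^sub>3\<in>verts G. \<forall>i\<^sub>4\<in>verts G.
      \<forall>\<alpha>\<^sub>1\<in>arcs_between G i\<^sub>1 i\<^sub>2. \<forall>\<alpha>\<^sub>2\<in>arcs_between G i\<^sub>3 i\<^sub>2.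
      \<forall>\<alpha>\<^sub>3\<in>arcs_between G i\<^sub>3 i\<^sub>4. \<forall>\<alpha>\<^sub>4\<in>arcs_between G i\<^sub>1 i\<^sub>4.
        (\<Sum>k\<in>verts G.
         \<Sum>\<beta>\<^sub>1\<in>arcs_between G i\<^sub>2 k. \<Sum>\<beta>\<^sub>2\<in>arcs_between G k i\<^sub>1.
         \<Sum>\<beta>\<^sub>3\<in>arcs_between G k i\<^sub>3. \<Sum>\<beta>\<^sub>4\<in>arcs_between G i\<^sub>4 k.
            of_real (inverse (\<phi> k))
            * W \<alpha>\<^sub>1 \<beta>\<^sub>1 \<beta>\<^sub>2 * cnj (W \<alpha>\<^sub>2 \<beta>\<^sub>1 \<beta>\<^sub>3) * W \<alpha>\<^sub>3 \<beta>\<^sub>4 \<beta>\<^sub>3 * cnj (W \<alpha>\<^sub>4 \<beta>\<^sub>4 \<beta>\<^sub>2))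
        = of_bool (\<alpha>\<^sub>1 = \<alpha>\<^sub>4) * of_bool (\<alpha>\<^sub>2 = \<alpha>\<^sub>3) * of_real (\<phi> i\<^sub>1 * \<phi> i\<^sub>2 * \<phi> i\<^sub>3)
          + of_bool (\<alpha>\<^sub>1 = \<alpha>\<^sub>2) * of_bool (\<alpha>\<^sub>3 = \<alpha>\<^sub>4) * of_real (\<phi> i\<^sub>1 * \<phi> i\<^sub>2 * \<phi> i\<^sub>4))"

definition cell_system ::
    "('v, 'e) pre_digraph \<Rightarrow> ('v \<Rightarrow> real) \<Rightarrow> ('e \<Rightarrow> 'e \<Rightarrow> 'e \<Rightarrow> complex) \<Rightarrow> bool" where
  "cell_system G \<phi> W \<longleftrightarrow>
     fin_digraph G \<and> perron_frobenius_eigenvector G \<lbrakk>3\<rbrakk>\<^sub>q \<phi> \<and>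
     rotation_invariant G W \<and> type_I G \<phi> W \<and> type_II G \<phi> W"

definition unitary_on :: "'e set \<Rightarrow> ('e \<Rightarrow> 'e \<Rightarrow> complex) \<Rightarrow> bool" where
  "unitary_on A u \<longleftrightarrow>
     (\<forall>\<sigma>\<in>A. \<forall>\<sigma>'\<in>A. (\<Sum>\<tau>\<in>A. u \<sigma> \<tau> * cnj (u \<sigma>' \<tau>)) = of_bool (\<sigma> = \<sigma>')) \<and>
     (\<forall>\<sigma>\<in>A. \<forall>\<sigma>'\<in>A. (\<Sum>\<tau>\<in>A. cnj (u \<tau> \<sigma>) * u \<tau> \<sigma>') = of_bool (\<sigma> = \<sigma>'))"

definition equivalent_cell_systems ::
    "('v, 'e) pre_digraph \<Rightarrow> ('e \<Rightarrow> 'e \<Rightarrow> 'e \<Rightarrow> complex) \<Rightarrow>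
     ('e \<Rightarrow> 'e \<Rightarrow> 'e \<Rightarrow> complex) \<Rightarrow> bool" where
  "equivalent_cell_systems G W\<^sub>1 W\<^sub>2 \<longleftrightarrow>
     (\<exists>u :: 'v \<Rightarrow> 'v \<Rightarrow> 'e \<Rightarrow> 'e \<Rightarrow> complex.
        (\<forall>i\<in>verts G. \<forall>j\<in>verts G. arcs_between G i j \<noteq> {} \<longrightarrow>
           unitary_on (arcs_between G i j) (u i j)) \<and>
        (\<forall>i\<in>verts G. \<forall>j\<in>verts G. \<forall>k\<in>verts G.
         \<forall>\<sigma>\<in>arcs_between G i j. \<forall>\<rho>\<in>arcs_between G j k. \<forall>\<gamma>\<in>arcs_between G k i.
           W\<^sub>1 \<sigma> \<rho> \<gamma> =
             (\<Sum>\<sigma>'\<in>arcs_between G i j. \<Sum>\<rho>'\<in>arcs_between G j k. \<Sum>\<gamma>'\<in>arcs_between G k i.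
                u i j \<sigma> \<sigma>' * u j k \<rho> \<rho>' * u k i \<gamma> \<gamma>' * W\<^sub>2 \<sigma>' \<rho>' \<gamma>')))"


section \<open>The graph E24 and its cells\<close>

definition E24 :: "(nat, nat \<times> nat) pre_digraph" where
  "E24 = \<lparr> verts = {1..24},
     arcs =
       {1} \<times> {9} \<union> {2} \<times> {9,10,11} \<union> {3} \<times> {10,12,14} \<union> {4} \<times> {11,12,14} \<union>
       {5} \<times> {11,13,14} \<union> {6} \<times> {11,13,15} \<union> {7} \<times> {14,15,16} \<union> {8} \<times> {16} \<union>
       {9} \<times> {17,18} \<union> {10} \<times> {17,19} \<union> {11} \<times> {18,19,20,22} \<union> {12} \<times> {19,21} \<union>
       {13} \<times> {20,22} \<union> {14} \<times> {19,21,22,23} \<union> {15} \<times> {22,24} \<union> {16} \<times> {23,24} \<union>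
       {17} \<times> {1,2} \<union> {18} \<times> {2,6} \<union> {19} \<times> {2,3,4,5} \<union> {20} \<times> {5,6} \<union>
       {21} \<times> {3,4} \<union> {22} \<times> {4,5,6,7} \<union> {23} \<times> {3,7} \<union> {24} \<times> {7,8},
     tail = fst, head = snd \<rparr>"

definition phi24 :: "nat \<Rightarrow> real" where
  "phi24 i =
    (if i \<in> {1,8} then 1
     else if i \<in> {2,7} then \<lbrakk>2\<rbrakk>\<^sub>q * \<lbrakk>4\<rbrakk>\<^sub>q
     else if i \<in> {3,6} then \<lbrakk>4\<rbrakk>\<^sub>q * \<lbrakk>5\<rbrakk>\<^sub>q / \<lbrakk>2\<rbrakk>\<^sub>q
     else if i \<in> {4,5} then \<lbrakk>4\<rbrakk>\<^sub>q * \<lbrakk>7\<rbrakk>\<^sub>q / \<lbrakk>2\<rbrakk>\<^sub>q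
     else if i \<in> {9,16,17,24} then \<lbrakk>3\<rbrakk>\<^sub>q
     else if i \<in> {10,15,18,23} then \<lbrakk>3\<rbrakk>\<^sub>q * \<lbrakk>4\<rbrakk>\<^sub>q / \<lbrakk>2\<rbrakk>\<^sub>q
     else if i \<in> {11,14,19,22} then \<lbrakk>3\<rbrakk>\<^sub>q * \<lbrakk>5\<rbrakk>\<^sub>q
     else if i \<in> {12,13,20,21} then \<lbrakk>9\<rbrakk>\<^sub>q
     else 0)"

text \<open>Every triangle of the graph has exactly one rotation \<open>a \<rightarrow> b \<rightarrow> c \<rightarrow> a\<close> with
  \<open>a \<in> {1..8}\<close>, \<open>b \<in> {9..16}\<close>, \<open>c \<in> {17..24}\<close>, and all of these occur below; the
  final \<open>0\<close> is never attained on a triangle.\<close>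

definition cell24 :: "nat \<Rightarrow> nat \<Rightarrow> nat \<Rightarrow> real" where
  "cell24 a b c =
    (if (a,b,c) \<in> {(1,9,17), (8,16,24)} then sqrt (\<lbrakk>2\<rbrakk>\<^sub>q * \<lbrakk>3\<rbrakk>\<^sub>q)
     else if (a,b,c) \<in> {(2,9,17), (7,16,24)} then sqrt (\<lbrakk>3\<rbrakk>\<^sub>q * \<lbrakk>4\<rbrakk>\<^sub>q)
     else if (a,b,c) \<in> {(2,9,18), (2,10,17), (7,15,24), (7,16,23)} then \<lbrakk>3\<rbrakk>\<^sub>q * sqrt \<lbrakk>4\<rbrakk>\<^sub>q
     else if (a,b,c) \<in> {(2,10,19), (2,11,18), (7,14,23), (7,15,22)}
       then sqrt (\<lbrakk>3\<rbrakk>\<^sub>q * \<lbrakk>4\<rbrakk>\<^sub>q * \<lbrakk>5\<rbrakk>\<^sub>q)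
     else if (a,b,c) \<in> {(2,11,19), (7,14,22)} then \<lbrakk>3\<rbrakk>\<^sub>q * sqrt (\<lbrakk>4\<rbrakk>\<^sub>q * \<lbrakk>5\<rbrakk>\<^sub>q)
     else if (a,b,c) \<in> {(3,10,19), (3,14,23), (6,11,18), (6,15,22)}
       then \<lbrakk>4\<rbrakk>\<^sub>q * sqrt (\<lbrakk>3\<rbrakk>\<^sub>q * \<lbrakk>5\<rbrakk>\<^sub>q) / sqrt \<lbrakk>2\<rbrakk>\<^sub>q
     else if (a,b,c) \<in> {(4,11,19), (4,14,22), (5,11,19), (5,14,22)}
       then sqrt (\<lbrakk>4\<rbrakk>\<^sub>q * \<lbrakk>5\<rbrakk>\<^sub>q * \<lbrakk>7\<rbrakk>\<^sub>q)
     else if (a,b,c) \<in> {(4,12,19), (4,14,21), (5,11,20), (5,13,22)}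
       then \<lbrakk>3\<rbrakk>\<^sub>q * sqrt (\<lbrakk>5\<rbrakk>\<^sub>q * \<lbrakk>9\<rbrakk>\<^sub>q) / sqrt \<lbrakk>2\<rbrakk>\<^sub>q
     else if (a,b,c) \<in> {(3,12,19), (3,14,21), (6,11,20), (6,13,22)}
       then sqrt (\<lbrakk>3\<rbrakk>\<^sub>q * \<lbrakk>5\<rbrakk>\<^sub>q * \<lbrakk>9\<rbrakk>\<^sub>q) / sqrt \<lbrakk>2\<rbrakk>\<^sub>q
     else if (a,b,c) \<in> {(3,14,19), (6,11,22)} then \<lbrakk>3\<rbrakk>\<^sub>q * \<lbrakk>5\<rbrakk>\<^sub>q / sqrt \<lbrakk>2\<rbrakk>\<^sub>q
     else if (a,b,c) \<in> {(4,14,19), (5,11,22)} then \<lbrakk>5\<rbrakk>\<^sub>q * sqrt \<lbrakk>7\<rbrakk>\<^sub>q / sqrt \<lbrakk>2\<rbrakk>\<^sub>q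
     else if (a,b,c) = (5,14,19) then sqrt (\<lbrakk>5\<rbrakk>\<^sub>q * \<lbrakk>7\<rbrakk>\<^sub>q * \<lbrakk>10\<rbrakk>\<^sub>q)
     else if (a,b,c) = (4,11,22) then - sqrt (\<lbrakk>5\<rbrakk>\<^sub>q * \<lbrakk>7\<rbrakk>\<^sub>q * \<lbrakk>10\<rbrakk>\<^sub>q)
     else if (a,b,c) \<in> {(3,12,21), (6,13,20)} then - (\<lbrakk>5\<rbrakk>\<^sub>q * sqrt \<lbrakk>9\<rbrakk>\<^sub>q / sqrt \<lbrakk>2\<rbrakk>\<^sub>q)
     else if (a,b,c) \<in> {(4,12,21), (5,13,20)} then sqrt (\<lbrakk>7\<rbrakk>\<^sub>q * \<lbrakk>9\<rbrakk>\<^sub>q) / sqrt \<lbrakk>2\<rbrakk>\<^sub>q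
     else 0)"

text \<open>The rotation-invariant extension: rotate until the triangle starts in \<open>{1..8}\<close>.\<close>

definition W24 :: "nat \<times> nat \<Rightarrow> nat \<times> nat \<Rightarrow> nat \<times> nat \<Rightarrow> complex" where
  "W24 \<alpha> \<beta> \<gamma> = of_real
    (if fst \<alpha> \<le> 8 then cell24 (fst \<alpha>) (fst \<beta>) (fst \<gamma>)
     else if fst \<beta> \<le> 8 then cell24 (fst \<beta>) (fst \<gamma>) (fst \<alpha>)
     else cell24 (fst \<gamma>) (fst \<alpha>) (fst \<beta>))"

end

theory Submission
  imports Defs
begin

text \<open>Regard the triangles of the graph as the faces of a 2-complex: its vertices and edges are those of
  the graph, and the 40 triangles are oriented as closed paths, so that an edge has the same
  orientation in all triangles through it. This complex consists of three octahedra, with opposite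
  pairs of vertices \<open>3,4 | 12,14 | 19,21\<close>, \<open>4,5 | 11,14 | 19,22\<close> and \<open>5,6 | 11,13 | 20,22\<close>, where
  consecutive ones share one face, and of 18 further triangles that can be pushed in from free edges.
  Both halves of the uniqueness proof exploit this shape.

  For the moduli, let \<open>D\<close> be the difference of the squared moduli of two cell systems. Condition (I)
  says that \<open>D\<close> sums to \<open>0\<close> over the triangles through each edge, so \<open>D\<close> is a 2-cycle. Since the
  18 triangles collapse, \<open>D\<close> vanishes on them and is a combination of the fundamental cycles of the three
  octahedra. On each octahedron one face shares an edge with one of the 18 triangles in such a way
  that an instance of condition (II) has a single summand, the product of the squared moduli on these
  two triangles; this makes \<open>D\<close> vanish on the face. Removing one face from each octahedron leaves a
  complex that collapses, so \<open>D = 0\<close> (\<open>unique_moduli\<close>).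

  For the phases, collapsing the remaining 37 triangles backwards adds them one at a time, each with
  an edge that no earlier triangle has; the unitary scalar of this edge can be chosen to match the
  phase of the triangle (\<open>gauge_on_peelable\<close>). For each of the three removed faces, condition (II)
  with four different vertices is a vanishing sum of two terms that involve exactly the eight faces of the
  octahedron; it is invariant under the choice of scalars and determines the value on the last face from
  the other seven (\<open>gauge_through_octahedron\<close>, \<open>unique_up_to_gauge\<close>).

  That the given numbers form a cell system is a finite computation. All
  entries of the eigenvector, and all squared cells divided by \<open>[2]\<close>, lie in the ring generated by
  \<open>\<tau> = 2 cos (\<pi>/12)\<close>, where \<open>\<tau>\<^sup>4 = 4\<tau>\<^sup>2 - 1\<close>. Condition (I), and condition (II) for \<open>i\<^sub>1 = i\<^sub>3\<close> or
  \<open>i\<^sub>2 = i\<^sub>4\<close>, only involve these squares and become identities between integer quadruples. In the other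
  cases of (II) the two summands must cancel, which holds because they have the same square and opposite
  signs. The bound on the moduli of the eigenvalues follows from the existence of a positive eigenvector.\<close>

section \<open>The eigenvalue of a positive eigenvector\<close>

text \<open>In the supremum norm weighted by \<open>1/\<phi>\<close>, the matrix has operator norm \<open>\<theta>\<close>: compare the eigenvalue
  equations at an index where \<open>|x i| / \<phi> i\<close> is largest.\<close>

lemma nonneg_matrix_eigenvalue_bound:
  fixes A :: "'v \<Rightarrow> 'v \<Rightarrow> nat" and \<phi> :: "'v \<Rightarrow> real" and x :: "'v \<Rightarrow> complex"
  assumes "finite V" and pos: "\<And>i. i \<in> V \<Longrightarrow> \<phi> i > 0"
    and \<phi>: "\<And>i. i \<in> V \<Longrightarrow> (\<Sum>j\<in>V. of_nat (A i j) * \<phi> j) = \<theta> * \<phi> i"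
    and x: "\<And>i. i \<in> V \<Longrightarrow> (\<Sum>j\<in>V. of_nat (A i j) * x j) = \<mu> * x i"
    and nonzero: "\<exists>i\<in>V. x i \<noteq> 0"
  shows "cmod \<mu> \<le> \<theta>"
proof -
  define c where "c i = cmod (x i) / \<phi> i" for i
  have "V \<noteq> {}" using nonzero by blast
  then have "Max (c ` V) \<in> c ` V" using \<open>finite V\<close> by (intro Max_in) auto
  then obtain m where m: "m \<in> V" "c m = Max (c ` V)" by (metis imageE)
  have max: "c j \<le> c m" if "j \<in> V" for j
    using that \<open>finite V\<close> m by simp
  obtain n where "n \<in> V" "x n \<noteq> 0" using nonzero by blast
  then have "c n > 0" using pos by (simp add: c_def)
  then have "c m > 0" using max[OF \<open>n \<in> V\<close>] by simp
  then have xm: "cmod (x m) > 0" "c m * \<phi> m = cmod (x m)" using pos[OF m(1)]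
    by (auto simp: c_def zero_less_divide_iff)
  have "cmod \<mu> * cmod (x m) = cmod (\<Sum>j\<in>V. of_nat (A m j) * x j)"
    by (simp add: x[OF m(1)] norm_mult)
  also have "\<dots> \<le> (\<Sum>j\<in>V. of_nat (A m j) * cmod (x j))"
    by (rule order_trans[OF norm_sum]) (simp add: norm_mult)
  also have "\<dots> \<le> (\<Sum>j\<in>V. of_nat (A m j) * (c m * \<phi> j))"
  proof (intro sum_mono mult_left_mono)
    fix j assume "j \<in> V"
    then show "cmod (x j) \<le> c m * \<phi> j"
      using max[of j] pos[of j] by (simp add: c_def field_simps)
  qed simp
  also have "\<dots> = c m * (\<Sum>j\<in>V. of_nat (A m j) * \<phi> j)"
    by (simp add: sum_distrib_left mult_ac)
  also have "\<dots> = \<theta> * cmod (x m)" by (simp add: \<phi>[OF m(1)] flip: xm(2))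
  finally show ?thesis using xm(1) by simp
qed

section \<open>The graph and its triangles\<close>

text \<open>Adjacency lists make the quantifiers over edges and triangles computable. Entry \<open>0\<close> is a
  placeholder, so that positions agree with vertex numbers.\<close>

definition succs :: "nat \<Rightarrow> nat list" where
  "succs i = (if i < 25 then
    [[], [9], [9,10,11], [10,12,14], [11,12,14], [11,13,14], [11,13,15], [14,15,16], [16],
     [17,18], [17,19], [18,19,20,22], [19,21], [20,22], [19,21,22,23], [22,24], [23,24],
     [1,2], [2,6], [2,3,4,5], [5,6], [3,4], [4,5,6,7], [3,7], [7,8]] ! i else [])"

definition third :: "nat \<Rightarrow> nat \<Rightarrow> nat list" where
  "third i j = [k \<leftarrow> succs j. i \<in> set (succs k)]"

text \<open>The index set of condition (II): a 4-cycle \<open>i\<^sub>1 \<rightarrow> i\<^sub>2 \<leftarrow> i\<^sub>3 \<rightarrow> i\<^sub>4 \<leftarrow> i\<^sub>1\<close> of alternating orientation,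
  possibly degenerate. The function \<open>apexes\<close> below lists the vertices that form a triangle with each of
  its edges, over which the sum in (II) runs.\<close>

definition frame :: "nat \<Rightarrow> nat \<Rightarrow> nat \<Rightarrow> nat \<Rightarrow> bool" where
  "frame i\<^sub>1 i\<^sub>2 i\<^sub>3 i\<^sub>4 \<longleftrightarrow> i\<^sub>2 \<in> set (succs i\<^sub>1) \<and> i\<^sub>2 \<in> set (succs i\<^sub>3) \<and>
     i\<^sub>4 \<in> set (succs i\<^sub>3) \<and> i\<^sub>4 \<in> set (succs i\<^sub>1)"

definition apexes :: "nat \<Rightarrow> nat \<Rightarrow> nat \<Rightarrow> nat \<Rightarrow> nat list" where
  "apexes i\<^sub>1 i\<^sub>2 i\<^sub>3 i\<^sub>4 =
     [k \<leftarrow> third i\<^sub>1 i\<^sub>2. k \<in> set (third i\<^sub>3 i\<^sub>2) \<and> k \<in> set (third i\<^sub>3 i\<^sub>4) \<and> k \<in> set (third i\<^sub>1 i\<^sub>4)]"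

lemma verts_E24 [simp]: "verts E24 = {1..24}" by (simp add: E24_def)

lemma tail_head_E24 [simp]: "tail E24 = fst" "head E24 = snd" by (simp_all add: E24_def)

lemma arcs_E24: "(i, j) \<in> arcs E24 \<longleftrightarrow> j \<in> set (succs i)"
proof -
  have "arcs E24 = set [(i, j). i \<leftarrow> [0..<25], j \<leftarrow> succs i]"
    unfolding E24_def pre_digraph.simps by code_simp
  then show ?thesis by (auto simp: succs_def split: if_splits)
qed

lemma succs_verts:
  assumes "j \<in> set (succs i)" shows "i \<in> {1..24}" "j \<in> {1..24}"
  using assms by (auto simp: E24_def simp flip: arcs_E24)

lemma distinct_succs: "distinct (succs i)"
proof (cases "i < 25")
  case True
  moreover have "list_all (\<lambda>i. distinct (succs i)) [0..<25]" by code_simp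
  ultimately show ?thesis by (simp only: list_all_iff set_upt) auto
qed (simp add: succs_def)

lemma arcs_between_E24:
  "arcs_between E24 i j = (if j \<in> set (succs i) then {(i, j)} else {})"
  by (auto simp: arcs_between_def arcs_E24)

lemma fin_digraph_E24: "fin_digraph E24"
proof
  show "finite (arcs E24)" by (simp add: E24_def)
qed (use succs_verts in \<open>auto simp: arcs_E24 simp del: atLeastAtMost_iff\<close>)

text \<open>Since the graph has no multiple edges, a triangle is given by its vertices.\<close>

definition on_cell :: "(nat \<times> nat \<Rightarrow> nat \<times> nat \<Rightarrow> nat \<times> nat \<Rightarrow> 'a) \<Rightarrow> nat \<Rightarrow> nat \<Rightarrow> nat \<Rightarrow> 'a" where
  "on_cell W i j k = W (i, j) (j, k) (k, i)"

lemma sum_verts_eq_sum_list: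
  fixes f :: "nat \<Rightarrow> 'a::comm_monoid_add"
  assumes "\<And>k. k \<in> {1..24} \<Longrightarrow> k \<notin> set ks \<Longrightarrow> f k = 0" "distinct ks" "set ks \<subseteq> {1..24}"
  shows "(\<Sum>k\<in>{1..24}. f k) = sum_list (map f ks)"
  using assms by (subst sum_list_distinct_conv_sum_set) (auto intro: sum.mono_neutral_right)

lemma type_I_E24:
  "type_I E24 \<phi> W \<longleftrightarrow> (\<forall>i j. j \<in> set (succs i) \<longrightarrow>
     (\<Sum>k\<leftarrow>third i j. on_cell W i j k * cnj (on_cell W i j k)) = of_real (\<lbrakk>2\<rbrakk>\<^sub>q * \<phi> i * \<phi> j))"
proof -
  have *: "(\<Sum>k\<in>verts E24. \<Sum>\<beta>\<in>arcs_between E24 j k. \<Sum>\<gamma>\<in>arcs_between E24 k i.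
            W (i, j) \<beta> \<gamma> * cnj (W (i, j) \<beta> \<gamma>)) = (\<Sum>k\<leftarrow>third i j. on_cell W i j k * cnj (on_cell W i j k))"
    for i j
    unfolding verts_E24
    apply (subst sum_verts_eq_sum_list[where ks = "third i j"])
    using succs_verts distinct_succs
    by (auto simp: arcs_between_E24 third_def on_cell_def intro!: arg_cong[where f=sum_list] map_cong)
  have mem: "\<alpha> \<in> arcs_between E24 i j \<longleftrightarrow> \<alpha> = (i, j) \<and> j \<in> set (succs i)" for \<alpha> i j
    by (simp add: arcs_between_E24)
  show ?thesis
    unfolding type_I_def
    apply (simp add: mem * del: verts_E24)
    using succs_verts unfolding verts_E24 by blast
qed

lemma type_II_E24:
  "type_II E24 \<phi> W \<longleftrightarrow> (\<forall>i\<^sub>1 i\<^sub>2 i\<^sub>3 i\<^sub>4. frame i\<^sub>1 i\<^sub>2 i\<^sub>3 i\<^sub>4 \<longrightarrow>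
     (\<Sum>k\<leftarrow>apexes i\<^sub>1 i\<^sub>2 i\<^sub>3 i\<^sub>4. of_real (inverse (\<phi> k)) * on_cell W i\<^sub>1 i\<^sub>2 k *
        cnj (on_cell W i\<^sub>3 i\<^sub>2 k) * on_cell W i\<^sub>3 i\<^sub>4 k * cnj (on_cell W i\<^sub>1 i\<^sub>4 k))
     = of_bool (i\<^sub>2 = i\<^sub>4) * of_real (\<phi> i\<^sub>1 * \<phi> i\<^sub>2 * \<phi> i\<^sub>3)
       + of_bool (i\<^sub>1 = i\<^sub>3) * of_real (\<phi> i\<^sub>1 * \<phi> i\<^sub>2 * \<phi> i\<^sub>4))"
proof -
  have *: "(\<Sum>k\<in>verts E24.
         \<Sum>\<beta>\<^sub>1\<in>arcs_between E24 i\<^sub>2 k. \<Sum>\<beta>\<^sub>2\<in>arcs_between E24 k i\<^sub>1.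
         \<Sum>\<beta>\<^sub>3\<in>arcs_between E24 k i\<^sub>3. \<Sum>\<beta>\<^sub>4\<in>arcs_between E24 i\<^sub>4 k.
            of_real (inverse (\<phi> k))
            * W (i\<^sub>1, i\<^sub>2) \<beta>\<^sub>1 \<beta>\<^sub>2 * cnj (W (i\<^sub>3, i\<^sub>2) \<beta>\<^sub>1 \<beta>\<^sub>3) * W (i\<^sub>3, i\<^sub>4) \<beta>\<^sub>4 \<beta>\<^sub>3 * cnj (W (i\<^sub>1, i\<^sub>4) \<beta>\<^sub>4 \<beta>\<^sub>2))
     = (\<Sum>k\<leftarrow>apexes i\<^sub>1 i\<^sub>2 i\<^sub>3 i\<^sub>4. of_real (inverse (\<phi> k)) * on_cell W i\<^sub>1 i\<^sub>2 k *
        cnj (on_cell W i\<^sub>3 i\<^sub>2 k) * on_cell W i\<^sub>3 i\<^sub>4 k * cnj (on_cell W i\<^sub>1 i\<^sub>4 k))"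
    for i\<^sub>1 i\<^sub>2 i\<^sub>3 i\<^sub>4
    unfolding verts_E24
    apply (subst sum_verts_eq_sum_list[where ks = "apexes i\<^sub>1 i\<^sub>2 i\<^sub>3 i\<^sub>4"])
    using succs_verts distinct_succs
    by (auto simp: arcs_between_E24 apexes_def third_def on_cell_def intro!: arg_cong[where f=sum_list] map_cong)
  have mem: "\<alpha> \<in> arcs_between E24 i j \<longleftrightarrow> \<alpha> = (i, j) \<and> j \<in> set (succs i)" for \<alpha> i j
    by (simp add: arcs_between_E24)
  show ?thesis (is "?L \<longleftrightarrow> ?R")
  proof
    assume L: ?L
    show ?R
    proof (intro allI impI)
      fix i\<^sub>1 i\<^sub>2 i\<^sub>3 i\<^sub>4
      assume "frame i\<^sub>1 i\<^sub>2 i\<^sub>3 i\<^sub>4"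
      then have a: "i\<^sub>2 \<in> set (succs i\<^sub>1)" "i\<^sub>2 \<in> set (succs i\<^sub>3)"
          "i\<^sub>4 \<in> set (succs i\<^sub>3)" "i\<^sub>4 \<in> set (succs i\<^sub>1)"
        by (auto simp: frame_def)
      then have v: "i\<^sub>1 \<in> verts E24" "i\<^sub>2 \<in> verts E24" "i\<^sub>3 \<in> verts E24" "i\<^sub>4 \<in> verts E24"
        unfolding verts_E24 using succs_verts by blast+
      show "(\<Sum>k\<leftarrow>apexes i\<^sub>1 i\<^sub>2 i\<^sub>3 i\<^sub>4. of_real (inverse (\<phi> k)) * on_cell W i\<^sub>1 i\<^sub>2 k *
        cnj (on_cell W i\<^sub>3 i\<^sub>2 k) * on_cell W i\<^sub>3 i\<^sub>4 k * cnj (on_cell W i\<^sub>1 i\<^sub>4 k))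
     = of_bool (i\<^sub>2 = i\<^sub>4) * of_real (\<phi> i\<^sub>1 * \<phi> i\<^sub>2 * \<phi> i\<^sub>3)
       + of_bool (i\<^sub>1 = i\<^sub>3) * of_real (\<phi> i\<^sub>1 * \<phi> i\<^sub>2 * \<phi> i\<^sub>4)"
        using L[unfolded type_II_def, rule_format, OF v, of "(i\<^sub>1, i\<^sub>2)" "(i\<^sub>3, i\<^sub>2)" "(i\<^sub>3, i\<^sub>4)" "(i\<^sub>1, i\<^sub>4)"] a
        by (simp add: mem * del: verts_E24 of_real_inverse)
    qed
  next
    assume R: ?R
    show ?L
      unfolding type_II_def
    proof (intro ballI)
      fix i\<^sub>1 i\<^sub>2 i\<^sub>3 i\<^sub>4 \<alpha>\<^sub>1 \<alpha>\<^sub>2 \<alpha>\<^sub>3 \<alpha>\<^sub>4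
      assume "\<alpha>\<^sub>1 \<in> arcs_between E24 i\<^sub>1 i\<^sub>2" "\<alpha>\<^sub>2 \<in> arcs_between E24 i\<^sub>3 i\<^sub>2"
        "\<alpha>\<^sub>3 \<in> arcs_between E24 i\<^sub>3 i\<^sub>4" "\<alpha>\<^sub>4 \<in> arcs_between E24 i\<^sub>1 i\<^sub>4"
      then show "(\<Sum>k\<in>verts E24.
         \<Sum>\<beta>\<^sub>1\<in>arcs_between E24 i\<^sub>2 k. \<Sum>\<beta>\<^sub>2\<in>arcs_between E24 k i\<^sub>1.
         \<Sum>\<beta>\<^sub>3\<in>arcs_between E24 k i\<^sub>3. \<Sum>\<beta>\<^sub>4\<in>arcs_between E24 i\<^sub>4 k.
            of_real (inverse (\<phi> k))
            * W \<alpha>\<^sub>1 \<beta>\<^sub>1 \<beta>\<^sub>2 * cnj (W \<alpha>\<^sub>2 \<beta>\<^sub>1 \<beta>\<^sub>3) * W \<alpha>\<^sub>3 \<beta>\<^sub>4 \<beta>\<^sub>3 * cnj (W \<alpha>\<^sub>4 \<beta>\<^sub>4 \<beta>\<^sub>2))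
        = of_bool (\<alpha>\<^sub>1 = \<alpha>\<^sub>4) * of_bool (\<alpha>\<^sub>2 = \<alpha>\<^sub>3) * of_real (\<phi> i\<^sub>1 * \<phi> i\<^sub>2 * \<phi> i\<^sub>3)
          + of_bool (\<alpha>\<^sub>1 = \<alpha>\<^sub>2) * of_bool (\<alpha>\<^sub>3 = \<alpha>\<^sub>4) * of_real (\<phi> i\<^sub>1 * \<phi> i\<^sub>2 * \<phi> i\<^sub>4)"
        using R[rule_format, of i\<^sub>1 i\<^sub>2 i\<^sub>3 i\<^sub>4] by (simp add: frame_def mem * del: verts_E24 of_real_inverse)
    qed
  qed
qed

section \<open>Quantum integers in terms of \<open>\<tau>\<close>\<close>

definition \<tau> :: real where "\<tau> = 2 * cos (pi / 12)"

text \<open>This is \<open>(\<tau>\<^sup>2 - 2)\<^sup>2 = 3\<close>, the double angle formula for \<open>cos (\<pi>/6) = \<surd>3 / 2\<close>.\<close>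

lemma tau_power4: "\<tau> ^ 4 = 4 * \<tau> ^ 2 - 1"
proof -
  have "2 * (cos (pi / 12))\<^sup>2 - 1 = sqrt 3 / 2"
    using cos_double_cos[of "pi / 12"] cos_30 by simp
  then have "\<tau>\<^sup>2 - 2 = sqrt 3" by (simp add: \<tau>_def power_mult_distrib)
  then have "(\<tau>\<^sup>2 - 2)\<^sup>2 = 3" by simp
  then show ?thesis by (simp add: power2_eq_square power4_eq_xxxx algebra_simps)
qed

lemma qint_sin: "\<lbrakk>m\<rbrakk>\<^sub>q = sin (m * (pi / 24)) / sin (pi / 24)"
proof -
  have q: "q = cis (pi / 24)" by (simp add: q_def cis_conv_exp)
  have "q ^ m = cis (m * (pi / 24))" "inverse q ^ m = cis (- (m * (pi / 24)))" for m
    unfolding q by (simp_all add: Complex.DeMoivre)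
  then have *: "q ^ m - inverse q ^ m = 2 * \<i> * of_real (sin (m * (pi / 24)))" for m
    by (simp add: complex_eq_iff)
  show ?thesis using *[of m] *[of 1] by (simp add: qint_def flip: of_real_divide)
qed

lemma qint_pos: "0 < m \<Longrightarrow> m < 24 \<Longrightarrow> \<lbrakk>m\<rbrakk>\<^sub>q > 0"
  unfolding qint_sin by (intro divide_pos_pos sin_gt_zero) (auto simp: field_simps)

lemma qint_2: "\<lbrakk>2\<rbrakk>\<^sub>q = 2 * cos (pi / 24)" and qint_2_squared: "\<lbrakk>2\<rbrakk>\<^sub>q\<^sup>2 = \<tau> + 2"
proof -
  have "sin (pi / 24) > 0" by (intro sin_gt_zero) auto
  then show *: "\<lbrakk>2\<rbrakk>\<^sub>q = 2 * cos (pi / 24)"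
    using sin_double[of "pi / 24"] by (simp add: qint_sin)
  show "\<lbrakk>2\<rbrakk>\<^sub>q\<^sup>2 = \<tau> + 2"
    using cos_double_cos[of "pi / 24"] by (simp add: * \<tau>_def power_mult_distrib)
qed

lemma qint_recursion: "\<lbrakk>m + 2\<rbrakk>\<^sub>q = \<lbrakk>2\<rbrakk>\<^sub>q * \<lbrakk>m + 1\<rbrakk>\<^sub>q - \<lbrakk>m\<rbrakk>\<^sub>q"
proof -
  have *: "sin (x + d) = 2 * cos d * sin x - sin (x - d)" for x d :: real
    by (simp add: sin_add sin_diff)
  show ?thesis
    using *[of "real (m + 1) * (pi / 24)" "pi / 24"]
    unfolding qint_2 by (simp add: qint_sin field_simps flip: diff_divide_distrib)
qed

text \<open>By the recursion, odd quantum integers are polynomials in \<open>[2]\<^sup>2 = \<tau> + 2\<close> and even ones are \<open>[2]\<close> times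
  such polynomials.\<close>

lemma qint_values:
  "\<lbrakk>3\<rbrakk>\<^sub>q = \<tau> + 1" "\<lbrakk>4\<rbrakk>\<^sub>q = \<lbrakk>2\<rbrakk>\<^sub>q * \<tau>" "\<lbrakk>5\<rbrakk>\<^sub>q = \<tau>\<^sup>2 + \<tau> - 1" "\<lbrakk>7\<rbrakk>\<^sub>q = \<tau> ^ 3 + \<tau>\<^sup>2 - 2 * \<tau> - 1"
  "\<lbrakk>9\<rbrakk>\<^sub>q = \<tau> ^ 3 + \<tau>\<^sup>2 - 2 * \<tau>" "\<lbrakk>10\<rbrakk>\<^sub>q = \<lbrakk>2\<rbrakk>\<^sub>q * \<tau>\<^sup>2"
proof -
  note x = qint_2_squared[unfolded power2_eq_square]
  have r: "\<lbrakk>n\<rbrakk>\<^sub>q = \<lbrakk>2\<rbrakk>\<^sub>q * \<lbrakk>k\<rbrakk>\<^sub>q - \<lbrakk>m\<rbrakk>\<^sub>q" if "n = m + 2" "k = m + 1" for n k m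
    using qint_recursion that by simp
  have r3: "\<lbrakk>3\<rbrakk>\<^sub>q = \<lbrakk>2\<rbrakk>\<^sub>q * \<lbrakk>2\<rbrakk>\<^sub>q - \<lbrakk>1\<rbrakk>\<^sub>q" and r4: "\<lbrakk>4\<rbrakk>\<^sub>q = \<lbrakk>2\<rbrakk>\<^sub>q * \<lbrakk>3\<rbrakk>\<^sub>q - \<lbrakk>2\<rbrakk>\<^sub>q"
    and r5: "\<lbrakk>5\<rbrakk>\<^sub>q = \<lbrakk>2\<rbrakk>\<^sub>q * \<lbrakk>4\<rbrakk>\<^sub>q - \<lbrakk>3\<rbrakk>\<^sub>q" and r6: "\<lbrakk>6\<rbrakk>\<^sub>q = \<lbrakk>2\<rbrakk>\<^sub>q * \<lbrakk>5\<rbrakk>\<^sub>q - \<lbrakk>4\<rbrakk>\<^sub>q"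
    and r7: "\<lbrakk>7\<rbrakk>\<^sub>q = \<lbrakk>2\<rbrakk>\<^sub>q * \<lbrakk>6\<rbrakk>\<^sub>q - \<lbrakk>5\<rbrakk>\<^sub>q" and r8: "\<lbrakk>8\<rbrakk>\<^sub>q = \<lbrakk>2\<rbrakk>\<^sub>q * \<lbrakk>7\<rbrakk>\<^sub>q - \<lbrakk>6\<rbrakk>\<^sub>q"
    and r9: "\<lbrakk>9\<rbrakk>\<^sub>q = \<lbrakk>2\<rbrakk>\<^sub>q * \<lbrakk>8\<rbrakk>\<^sub>q - \<lbrakk>7\<rbrakk>\<^sub>q" and r10: "\<lbrakk>10\<rbrakk>\<^sub>q = \<lbrakk>2\<rbrakk>\<^sub>q * \<lbrakk>9\<rbrakk>\<^sub>q - \<lbrakk>8\<rbrakk>\<^sub>q"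
    by (rule r; simp)+
  have "sin (pi / 24) \<noteq> 0" using sin_gt_zero[of "pi / 24"] by simp
  then have 1: "\<lbrakk>1\<rbrakk>\<^sub>q = 1" by (simp add: qint_sin)
  show 3: "\<lbrakk>3\<rbrakk>\<^sub>q = \<tau> + 1" using r3 1 x by simp
  show 4: "\<lbrakk>4\<rbrakk>\<^sub>q = \<lbrakk>2\<rbrakk>\<^sub>q * \<tau>" using r4 3 by algebra
  show 5: "\<lbrakk>5\<rbrakk>\<^sub>q = \<tau>\<^sup>2 + \<tau> - 1" using r5 3 4 x by algebra
  have 6: "\<lbrakk>6\<rbrakk>\<^sub>q = \<lbrakk>2\<rbrakk>\<^sub>q * (\<tau>\<^sup>2 - 1)" using r6 4 5 by algebra
  show 7: "\<lbrakk>7\<rbrakk>\<^sub>q = \<tau> ^ 3 + \<tau>\<^sup>2 - 2 * \<tau> - 1" using r7 5 6 x by algebra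
  have 8: "\<lbrakk>8\<rbrakk>\<^sub>q = \<lbrakk>2\<rbrakk>\<^sub>q * (\<tau> ^ 3 - 2 * \<tau>)" using r8 6 7 by algebra
  show 9: "\<lbrakk>9\<rbrakk>\<^sub>q = \<tau> ^ 3 + \<tau>\<^sup>2 - 2 * \<tau>" using r9 7 8 x tau_power4 by algebra
  show "\<lbrakk>10\<rbrakk>\<^sub>q = \<lbrakk>2\<rbrakk>\<^sub>q * \<tau>\<^sup>2" using r10 8 9 by algebra
qed

section \<open>Arithmetic in the ring generated by \<open>\<tau>\<close>\<close>

text \<open>Coordinates with respect to \<open>1, \<tau>, \<tau>\<^sup>2, \<tau>\<^sup>3\<close>. In the product, the powers \<open>\<tau>\<^sup>4 = 4\<tau>\<^sup>2 - 1\<close>,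
  \<open>\<tau>\<^sup>5 = 4\<tau>\<^sup>3 - \<tau>\<close> and \<open>\<tau>\<^sup>6 = 15\<tau>\<^sup>2 - 4\<close> are reduced.\<close>

datatype ztau = Z int int int int

primrec val :: "ztau \<Rightarrow> real" where
  "val (Z a b c d) = a + b * \<tau> + c * \<tau>\<^sup>2 + d * \<tau> ^ 3"

fun zadd :: "ztau \<Rightarrow> ztau \<Rightarrow> ztau" where
  "zadd (Z a b c d) (Z a' b' c' d') = Z (a + a') (b + b') (c + c') (d + d')"

fun zmul :: "ztau \<Rightarrow> ztau \<Rightarrow> ztau" where
  "zmul (Z a b c d) (Z a' b' c' d') =
    (let e = b * d' + c * c' + d * b'; f = c * d' + d * c'; g = d * d' in
     Z (a * a' - e - 4 * g) (a * b' + b * a' - f)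
       (a * c' + b * b' + c * a' + 4 * e + 15 * g)
       (a * d' + b * c' + c * b' + d * a' + 4 * f))"

definition zprod :: "ztau list \<Rightarrow> ztau" where "zprod zs = foldr zmul zs (Z 1 0 0 0)"
definition zsum :: "ztau list \<Rightarrow> ztau" where "zsum zs = foldr zadd zs (Z 0 0 0 0)"

lemma val_zadd: "val (zadd z w) = val z + val w"
  by (cases z; cases w) (simp add: algebra_simps)

lemma val_zmul: "val (zmul z w) = val z * val w"
proof (cases z; cases w)
  fix a b c d a' b' c' d' assume zw: "z = Z a b c d" "w = Z a' b' c' d'"
  define e f g where "e = b * d' + c * c' + d * b'" "f = c * d' + d * c'" "g = d * d'"
  \<comment> \<open>The cofactor comes from dividing \<open>e \<tau>\<^sup>4 + f \<tau>\<^sup>5 + g \<tau>\<^sup>6\<close> by \<open>\<tau>\<^sup>4 - 4\<tau>\<^sup>2 + 1\<close>.\<close>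
  have "val z * val w - val (zmul z w) = (e + f * \<tau> + g * (\<tau>\<^sup>2 + 4)) * (\<tau> ^ 4 - 4 * \<tau>\<^sup>2 + 1)"
    by (simp add: zw e_f_g_def Let_def algebra_simps power2_eq_square power3_eq_cube power4_eq_xxxx)
  then show ?thesis by (simp add: tau_power4)
qed

lemma val_zprod: "val (zprod zs) = prod_list (map val zs)"
  by (induction zs) (simp_all add: zprod_def val_zmul)

lemma val_zsum: "val (zsum zs) = sum_list (map val zs)"
  by (induction zs) (simp_all add: zsum_def val_zadd)

definition zphi :: "nat \<Rightarrow> ztau" where
  "zphi i =
    (if i \<in> {1,8} then Z 1 0 0 0
     else if i \<in> {2,7} then Z 0 2 1 0
     else if i \<in> {3,6} then Z 0 (-1) 1 1
     else if i \<in> {4,5} then Z (-1) (-1) 2 1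
     else if i \<in> {9,16,17,24} then Z 1 1 0 0
     else if i \<in> {10,15,18,23} then Z 0 1 1 0
     else if i \<in> {11,14,19,22} then Z (-1) 0 2 1
     else if i \<in> {12,13,20,21} then Z 0 (-2) 1 1
     else Z 0 0 0 0)"

text \<open>Coordinates of \<open>2 / \<phi>\<close>. The factor \<open>2\<close> clears denominators: \<open>[3] = \<tau> + 1\<close> has norm \<open>-2\<close> and is
  not a unit of the ring.\<close>

definition zpsi :: "nat \<Rightarrow> ztau" where
  "zpsi i =
    (if i \<in> {1,8} then Z 2 0 0 0
     else if i \<in> {2,7} then Z 0 4 (-2) 0
     else if i \<in> {3,6} then Z (-8) (-22) 2 6
     else if i \<in> {4,5} then Z (-14) 22 4 (-6)
     else if i \<in> {9,16,17,24} then Z 3 (-3) (-1) 1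
     else if i \<in> {10,15,18,23} then Z (-3) 11 1 (-3)
     else if i \<in> {11,14,19,22} then Z (-5) (-3) 1 1
     else Z (-1) (-5) 1 1)"

lemma phi24_val: "phi24 i = val (zphi i)"
proof -
  have x: "\<lbrakk>2\<rbrakk>\<^sub>q \<noteq> 0" using qint_pos[of 2] by simp
  have if_cong: "u = val z \<Longrightarrow> u' = val z' \<Longrightarrow> (if A then u else u') = val (if A then z else z')"
    for A u u' z z' by simp
  have 2: "\<lbrakk>2\<rbrakk>\<^sub>q * \<lbrakk>4\<rbrakk>\<^sub>q = val (Z 0 2 1 0)"
    using qint_2_squared by (simp add: qint_values) algebra
  show ?thesis
    unfolding phi24_def zphi_def
    apply (intro if_cong 2)
    apply (simp_all add: qint_values x)
    by (algebra add: tau_power4)+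
qed

lemma phi24_inverse:
  assumes "i \<in> {1..24}" shows "inverse (phi24 i) = val (zpsi i) / 2"
proof -
  have "list_all (\<lambda>i. zmul (zphi i) (zpsi i) = Z 2 0 0 0) [1..<25]" by code_simp
  then have "zmul (zphi i) (zpsi i) = Z 2 0 0 0" using assms by (auto simp: list_all_iff)
  then have "phi24 i * val (zpsi i) = 2" unfolding phi24_val val_zmul[symmetric] by simp
  then show ?thesis by (simp add: field_simps)
     (metis divide_inverse inverse_eq_divide mult.commute nonzero_divide_eq_eq mult_zero_left zero_neq_numeral)
qed

text \<open>The squared cells divided by \<open>[2]\<close>. Division by \<open>[2]\<close> stays in the ring because
  \<open>[2]\<^sup>2 = \<tau> + 2\<close> is a unit, with inverse \<open>2\<tau>\<^sup>2 - \<tau>\<^sup>3\<close>.\<close>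

definition zcell24 :: "nat \<Rightarrow> nat \<Rightarrow> nat \<Rightarrow> ztau" where
  "zcell24 a b c =
    (if (a,b,c) \<in> {(1,9,17), (8,16,24)} then Z 1 1 0 0
     else if (a,b,c) \<in> {(2,9,17), (7,16,24)} then Z 0 1 1 0
     else if (a,b,c) \<in> {(2,9,18), (2,10,17), (7,15,24), (7,16,23)} then Z 0 1 2 1
     else if (a,b,c) \<in> {(2,10,19), (2,11,18), (7,14,23), (7,15,22)} then Z (-1) (-1) 4 2
     else if (a,b,c) \<in> {(2,11,19), (7,14,22)} then Z (-3) (-2) 11 6
     else if (a,b,c) \<in> {(3,10,19), (3,14,23), (6,11,18), (6,15,22)} then Z (-2) (-1) 7 4
     else if (a,b,c) \<in> {(4,11,19), (4,14,22), (5,11,19), (5,14,22)} then Z (-2) (-1) 8 4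
     else if (a,b,c) \<in> {(4,12,19), (4,14,21), (5,11,20), (5,13,22)} then Z (-3) (-1) 11 5
     else if (a,b,c) \<in> {(3,12,19), (3,14,21), (6,11,20), (6,13,22)} then Z (-1) 0 3 2
     else if (a,b,c) \<in> {(3,14,19), (6,11,22)} then Z (-2) (-1) 8 3
     else if (a,b,c) \<in> {(4,14,19), (5,11,22)} then Z (-1) (-1) 4 3
     else if (a,b,c) = (5,14,19) then Z (-4) (-2) 15 8
     else if (a,b,c) = (4,11,22) then Z (-4) (-2) 15 8
     else if (a,b,c) \<in> {(3,12,21), (6,13,20)} then Z (-1) (-2) 6 3
     else if (a,b,c) \<in> {(4,12,21), (5,13,20)} then Z 0 0 1 1
     else Z 0 0 0 0)"

lemma cell24_squared: "(cell24 a b c)\<^sup>2 = \<lbrakk>2\<rbrakk>\<^sub>q * val (zcell24 a b c)"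
proof -
  have pos: "\<lbrakk>2\<rbrakk>\<^sub>q > 0" "\<lbrakk>3\<rbrakk>\<^sub>q > 0" "\<lbrakk>4\<rbrakk>\<^sub>q > 0" "\<lbrakk>5\<rbrakk>\<^sub>q > 0" "\<lbrakk>7\<rbrakk>\<^sub>q > 0" "\<lbrakk>9\<rbrakk>\<^sub>q > 0" "\<lbrakk>10\<rbrakk>\<^sub>q > 0"
    by (simp_all add: qint_pos)
  note sq = power_inverse power_mult_distrib power_divide real_sqrt_mult pos[THEN less_imp_le] real_sqrt_pow2
  have if_cong: "u\<^sup>2 = \<lbrakk>2\<rbrakk>\<^sub>q * val z \<Longrightarrow> u'\<^sup>2 = \<lbrakk>2\<rbrakk>\<^sub>q * val z' \<Longrightarrow>
      (if A then u else u')\<^sup>2 = \<lbrakk>2\<rbrakk>\<^sub>q * val (if A then z else z')" for A u u' z z'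
    by simp
  have x: "\<lbrakk>2\<rbrakk>\<^sub>q * inverse \<lbrakk>2\<rbrakk>\<^sub>q = 1" using pos by simp
  have y: "inverse \<lbrakk>2\<rbrakk>\<^sub>q = \<lbrakk>2\<rbrakk>\<^sub>q * (2 * \<tau>\<^sup>2 - \<tau> ^ 3)"
    using x qint_2_squared tau_power4 by algebra
  \<comment> \<open>Rewrite rules that reduce a fully multiplied out polynomial in \<open>\<tau>\<close> and \<open>[2]\<close>.\<close>
  have red: "\<tau> * (\<tau> * (\<tau> * \<tau>)) = 4 * (\<tau> * \<tau>) - 1" "\<tau> * (\<tau> * (\<tau> * (\<tau> * r))) = 4 * (\<tau> * (\<tau> * r)) - r"
    "\<lbrakk>2\<rbrakk>\<^sub>q * \<lbrakk>2\<rbrakk>\<^sub>q = \<tau> + 2" "\<lbrakk>2\<rbrakk>\<^sub>q * (\<lbrakk>2\<rbrakk>\<^sub>q * r) = (\<tau> + 2) * r" for r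
    using tau_power4 qint_2_squared by algebra+
  show ?thesis
    unfolding cell24_def zcell24_def
    apply (intro if_cong)
    apply (simp_all add: sq divide_inverse)
    apply (simp_all only: qint_values y)
    apply (simp_all add: algebra_simps power2_eq_square power3_eq_cube red)
    done
qed

section \<open>The given numbers form a cell system\<close>

text \<open>Every triangle passes through exactly one vertex of \<open>{1..8}\<close>; a function of triangles is given by its
  values at the rotation that starts there.\<close>

definition rotated :: "(nat \<Rightarrow> nat \<Rightarrow> nat \<Rightarrow> 'a) \<Rightarrow> nat \<Rightarrow> nat \<Rightarrow> nat \<Rightarrow> 'a" where
  "rotated f i j k = (if i \<le> 8 then f i j k else if j \<le> 8 then f j k i else f k i j)"

lemma on_cell_W24: "on_cell W24 i j k = of_real (rotated cell24 i j k)"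
  by (simp add: on_cell_def W24_def rotated_def)

definition cell_sign :: "nat \<Rightarrow> nat \<Rightarrow> nat \<Rightarrow> int" where
  "cell_sign a b c = (if (a,b,c) \<in> {(4,11,22), (3,12,21), (6,13,20)} then -1 else 1)"

text \<open>The triangles are listed in the order in which they can be removed: \<open>collar\<close> contains those outside
  the three octahedra, \<open>seeds\<close> one face of each octahedron, and \<open>punctured\<close> the remaining faces. The seeds
  are chosen such that each shares an edge with a triangle of \<open>collar\<close>.\<close>

definition collar :: "(nat \<times> nat \<times> nat) list" where
  "collar = [(1,9,17), (2,9,17), (2,9,18), (2,10,17), (2,10,19), (2,11,18), (2,11,19), (3,10,19),
     (3,14,23), (6,11,18), (6,15,22), (7,14,23), (7,14,22), (7,15,22), (7,15,24), (7,16,23),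
     (7,16,24), (8,16,24)]"

definition seeds :: "(nat \<times> nat \<times> nat) list" where
  "seeds = [(3,12,19), (4,11,19), (6,11,20)]"

definition punctured :: "(nat \<times> nat \<times> nat) list" where
  "punctured = [(3,12,21), (3,14,19), (3,14,21), (4,11,22), (4,12,19), (4,12,21), (4,14,19),
     (4,14,21), (4,14,22), (5,11,19), (5,11,20), (5,11,22), (5,13,20), (5,13,22), (5,14,19),
     (5,14,22), (6,11,22), (6,13,20), (6,13,22)]"

definition "triangles = collar @ seeds @ punctured"

fun edges :: "nat \<times> nat \<times> nat \<Rightarrow> (nat \<times> nat) list" where
  "edges (a, b, c) = [(a, b), (b, c), (c, a)]"

lemma rotated_triangle:
  assumes "j \<in> set (succs i)" "k \<in> set (third i j)"
  shows "rotated (\<lambda>a b c. (a, b, c)) i j k \<in> set triangles"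
proof -
  have "list_all (\<lambda>i. list_all (\<lambda>j. list_all (\<lambda>k. rotated (\<lambda>a b c. (a, b, c)) i j k \<in> set triangles) (third i j)) (succs i)) [1..<25]"
    by code_simp
  then show ?thesis using assms succs_verts[OF assms(1)] by (auto simp: list_all_iff)
qed

lemma rotated_cell:
  assumes "j \<in> set (succs i)" "k \<in> set (third i j)" "\<And>a b c. (a, b, c) \<in> set triangles \<Longrightarrow> P (f a b c) (g a b c)"
  shows "P (rotated f i j k) (rotated g i j k)"
  using rotated_triangle[OF assms(1,2)] assms(3) by (auto simp: rotated_def split: if_splits)

lemma rotated_cell24_squared: "(rotated cell24 i j k)\<^sup>2 = \<lbrakk>2\<rbrakk>\<^sub>q * val (rotated zcell24 i j k)"
  by (simp add: rotated_def cell24_squared)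

lemma sgn_cell24:
  assumes "(a, b, c) \<in> set triangles" shows "sgn (cell24 a b c) = of_int (cell_sign a b c)"
proof -
  have pos: "\<lbrakk>2\<rbrakk>\<^sub>q > 0" "\<lbrakk>3\<rbrakk>\<^sub>q > 0" "\<lbrakk>4\<rbrakk>\<^sub>q > 0" "\<lbrakk>5\<rbrakk>\<^sub>q > 0" "\<lbrakk>7\<rbrakk>\<^sub>q > 0" "\<lbrakk>9\<rbrakk>\<^sub>q > 0" "\<lbrakk>10\<rbrakk>\<^sub>q > 0"
    by (simp_all add: qint_pos)
  show ?thesis
    using assms unfolding triangles_def collar_def seeds_def punctured_def
    by (simp del: split_paired_All) (elim disjE; simp add: cell24_def cell_sign_def pos sgn_mult sgn_divide)
qed

lemma sgn_rotated_cell24: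
  assumes "j \<in> set (succs i)" "k \<in> set (third i j)"
  shows "sgn (rotated cell24 i j k) = of_int (rotated cell_sign i j k)"
  by (rule rotated_cell[OF assms]) (rule sgn_cell24)

lemma perron_frobenius_E24: "perron_frobenius_eigenvector E24 \<lbrakk>3\<rbrakk>\<^sub>q phi24"
proof -
  have A: "(\<Sum>j\<in>verts E24. of_nat (card (arcs_between E24 i j)) * x j) = (\<Sum>j\<leftarrow>succs i. x j)"
    for i and x :: "nat \<Rightarrow> 'a::real_algebra_1"
    unfolding verts_E24
    apply (subst sum_verts_eq_sum_list[where ks = "succs i"])
    using succs_verts distinct_succs
    by (auto simp: arcs_between_E24 intro!: arg_cong[where f=sum_list] map_cong)
  have pos: "phi24 i > 0" if "i \<in> verts E24" for i
  proof -
    have "i \<in> set [1..<25]" using that by simp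
    then show ?thesis by (simp add: upt_rec del: upt_Suc) (elim disjE; simp add: phi24_def qint_pos)
  qed
  have eig: "(\<Sum>j\<in>verts E24. of_nat (card (arcs_between E24 i j)) * phi24 j) = \<lbrakk>3\<rbrakk>\<^sub>q * phi24 i"
    if "i \<in> verts E24" for i
  proof -
    have "list_all (\<lambda>i. zsum (map zphi (succs i)) = zmul (Z 1 1 0 0) (zphi i)) [1..<25]"
      by code_simp
    then have "zsum (map zphi (succs i)) = zmul (Z 1 1 0 0) (zphi i)"
      using that by (auto simp: list_all_iff)
    then have "sum_list (map val (map zphi (succs i))) = val (Z 1 1 0 0) * val (zphi i)"
      unfolding val_zsum[symmetric] val_zmul[symmetric] by simp
    then show ?thesis unfolding A by (simp add: phi24_val qint_values o_def)
  qed
  show ?thesis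
    unfolding perron_frobenius_eigenvector_def
  proof (intro conjI ballI allI impI)
    fix \<mu> :: complex and x :: "nat \<Rightarrow> complex"
    assume "\<exists>i\<in>verts E24. x i \<noteq> 0" "\<forall>i\<in>verts E24. (\<Sum>j\<in>verts E24. of_nat (card (arcs_between E24 i j)) * x j) = \<mu> * x i"
    then show "cmod \<mu> \<le> \<lbrakk>3\<rbrakk>\<^sub>q"
      using nonneg_matrix_eigenvalue_bound[OF _ pos eig, of x \<mu>] by simp
  qed (use pos eig in auto)
qed

lemma of_real_sum_list: "of_real (sum_list xs) = sum_list (map of_real xs)"
  by (induction xs) simp_all

lemma rotation_invariant_W24: "rotation_invariant E24 W24"
proof -
  have "W24 \<alpha> \<beta> \<gamma> = W24 \<beta> \<gamma> \<alpha>" if "triangle E24 \<alpha> \<beta> \<gamma>" for \<alpha> \<beta> \<gamma>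
  proof -
    define i j k where "i = fst \<alpha>" "j = snd \<alpha>" "k = snd \<beta>"
    then have e: "\<alpha> = (i, j)" "\<beta> = (j, k)" "\<gamma> = (k, i)"
      using that by (auto simp: triangle_def prod_eq_iff)
    then have a: "j \<in> set (succs i)" "k \<in> set (succs j)" "i \<in> set (succs k)"
      using that by (auto simp: triangle_def arcs_E24)
    have "list_all (\<lambda>i. list_all (\<lambda>j. list_all (\<lambda>k. i \<le> 8 \<and> 8 < j \<and> 8 < k \<or> j \<le> 8 \<and> 8 < i \<and> 8 < k \<or> k \<le> 8 \<and> 8 < i \<and> 8 < j) (third i j)) (succs i)) [1..<25]"
      by code_simp
    then have "i \<le> 8 \<and> 8 < j \<and> 8 < k \<or> j \<le> 8 \<and> 8 < i \<and> 8 < k \<or> k \<le> 8 \<and> 8 < i \<and> 8 < j"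
      using a succs_verts[OF a(1)] by (auto simp: list_all_iff third_def)
    then show ?thesis by (auto simp: e W24_def)
  qed
  then show ?thesis unfolding rotation_invariant_def by blast
qed

lemma type_I_W24: "type_I E24 phi24 W24"
  unfolding type_I_E24
proof (intro allI impI)
  fix i j assume j: "j \<in> set (succs i)"
  have "list_all (\<lambda>i. list_all (\<lambda>j. zsum (map (rotated zcell24 i j) (third i j)) = zmul (zphi i) (zphi j)) (succs i)) [1..<25]"
    by code_simp
  then have "zsum (map (rotated zcell24 i j) (third i j)) = zmul (zphi i) (zphi j)"
    using j succs_verts[OF j] by (auto simp: list_all_iff)
  then have "val (zsum (map (rotated zcell24 i j) (third i j))) = val (zmul (zphi i) (zphi j))"
    by simp
  then have *: "(\<Sum>k\<leftarrow>third i j. val (rotated zcell24 i j k)) = phi24 i * phi24 j"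
    by (simp add: phi24_val val_zmul val_zsum o_def)
  have "(\<Sum>k\<leftarrow>third i j. on_cell W24 i j k * cnj (on_cell W24 i j k)) =
      of_real (\<Sum>k\<leftarrow>third i j. (rotated cell24 i j k)\<^sup>2)"
    by (simp add: on_cell_W24 power2_eq_square of_real_sum_list o_def)
  also have "\<dots> = of_real (\<lbrakk>2\<rbrakk>\<^sub>q * phi24 i * phi24 j)"
    by (simp add: rotated_cell24_squared sum_list_const_mult * )
  finally show "(\<Sum>k\<leftarrow>third i j. on_cell W24 i j k * cnj (on_cell W24 i j k)) = of_real (\<lbrakk>2\<rbrakk>\<^sub>q * phi24 i * phi24 j)" .
qed

text \<open>All 312 instances of condition (II).\<close>

definition frames :: "(nat \<times> nat \<times> nat \<times> nat) list" where
  "frames = [(i\<^sub>1, i\<^sub>2, i\<^sub>3, i\<^sub>4). i\<^sub>1 \<leftarrow> [1..<25], i\<^sub>2 \<leftarrow> succs i\<^sub>1, i\<^sub>3 \<leftarrow> [1..<25], i\<^sub>2 \<in> set (succs i\<^sub>3),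
     i\<^sub>4 \<leftarrow> succs i\<^sub>3, i\<^sub>4 \<in> set (succs i\<^sub>1)]"

lemma frames: "frame i\<^sub>1 i\<^sub>2 i\<^sub>3 i\<^sub>4 \<Longrightarrow> (i\<^sub>1, i\<^sub>2, i\<^sub>3, i\<^sub>4) \<in> set frames"
  using succs_verts[of i\<^sub>2 i\<^sub>1] succs_verts[of i\<^sub>2 i\<^sub>3] unfolding frame_def frames_def
  by force

text \<open>Condition (II) for \<open>i\<^sub>1 = i\<^sub>3\<close> or \<open>i\<^sub>2 = i\<^sub>4\<close>, multiplied by \<open>2\<close>. The four cells in a summand then form two
  pairs of equal ones, and the initial factor \<open>\<tau> + 2\<close> is the \<open>[2]\<^sup>2\<close> by which their squares differ from
  the products of values of \<open>zcell24\<close>.\<close>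

definition degenerate_identity :: "nat \<times> nat \<times> nat \<times> nat \<Rightarrow> bool" where
  "degenerate_identity = (\<lambda>(i\<^sub>1, i\<^sub>2, i\<^sub>3, i\<^sub>4).
     zmul (Z 2 1 0 0) (zsum (map (\<lambda>k. zprod [zpsi k, rotated zcell24 i\<^sub>1 i\<^sub>2 k,
         if i\<^sub>1 = i\<^sub>3 then rotated zcell24 i\<^sub>1 i\<^sub>4 k else rotated zcell24 i\<^sub>3 i\<^sub>2 k]) (apexes i\<^sub>1 i\<^sub>2 i\<^sub>3 i\<^sub>4)))
     = zprod [Z 2 0 0 0, zphi i\<^sub>1, zphi i\<^sub>2, zadd (if i\<^sub>2 = i\<^sub>4 then zphi i\<^sub>3 else Z 0 0 0 0)
         (if i\<^sub>1 = i\<^sub>3 then zphi i\<^sub>4 else Z 0 0 0 0)])"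

text \<open>The remaining instances: with two summands, condition (II) says that they are opposite numbers, that
  is, have equal squares and opposite signs. The common factor \<open>[2]\<^sup>4 / 4\<close> of the squares is left out.\<close>

definition octahedral_identity :: "nat \<times> nat \<times> nat \<times> nat \<Rightarrow> bool" where
  "octahedral_identity = (\<lambda>(i\<^sub>1, i\<^sub>2, i\<^sub>3, i\<^sub>4). case apexes i\<^sub>1 i\<^sub>2 i\<^sub>3 i\<^sub>4 of [k, l] \<Rightarrow>
     zprod [zpsi k, zpsi k, rotated zcell24 i\<^sub>1 i\<^sub>2 k, rotated zcell24 i\<^sub>3 i\<^sub>2 k, rotated zcell24 i\<^sub>3 i\<^sub>4 k, rotated zcell24 i\<^sub>1 i\<^sub>4 k] =
     zprod [zpsi l, zpsi l, rotated zcell24 i\<^sub>1 i\<^sub>2 l, rotated zcell24 i\<^sub>3 i\<^sub>2 l, rotated zcell24 i\<^sub>3 i\<^sub>4 l, rotated zcell24 i\<^sub>1 i\<^sub>4 l] \<and>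
     rotated cell_sign i\<^sub>1 i\<^sub>2 k * rotated cell_sign i\<^sub>3 i\<^sub>2 k * rotated cell_sign i\<^sub>3 i\<^sub>4 k * rotated cell_sign i\<^sub>1 i\<^sub>4 k =
     - (rotated cell_sign i\<^sub>1 i\<^sub>2 l * rotated cell_sign i\<^sub>3 i\<^sub>2 l * rotated cell_sign i\<^sub>3 i\<^sub>4 l * rotated cell_sign i\<^sub>1 i\<^sub>4 l)
    | _ \<Rightarrow> False)"

lemma frame_identities:
  "list_all (\<lambda>F. case F of (i\<^sub>1, i\<^sub>2, i\<^sub>3, i\<^sub>4) \<Rightarrow>
     if i\<^sub>1 = i\<^sub>3 \<or> i\<^sub>2 = i\<^sub>4 then degenerate_identity F else octahedral_identity F) frames"
  by code_simp

lemma squares_opposite_signs: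
  fixes x y :: real
  assumes "x\<^sup>2 = y\<^sup>2" "sgn x = - sgn y" shows "x + y = 0"
  using assms by (auto simp: power2_eq_iff sgn_if split: if_splits)

lemma type_II_W24: "type_II E24 phi24 W24"
proof -
  define r where "r = rotated cell24"
  have r2: "r i j k * r i j k = \<lbrakk>2\<rbrakk>\<^sub>q * val (rotated zcell24 i j k)" for i j k
    by (simp add: r_def flip: rotated_cell24_squared power2_eq_square)
  have x2: "\<lbrakk>2\<rbrakk>\<^sub>q * \<lbrakk>2\<rbrakk>\<^sub>q = \<tau> + 2" using qint_2_squared by (simp add: power2_eq_square)
  have "(\<Sum>k\<leftarrow>apexes i\<^sub>1 i\<^sub>2 i\<^sub>3 i\<^sub>4. inverse (phi24 k) * r i\<^sub>1 i\<^sub>2 k * r i\<^sub>3 i\<^sub>2 k * r i\<^sub>3 i\<^sub>4 k * r i\<^sub>1 i\<^sub>4 k)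
     = of_bool (i\<^sub>2 = i\<^sub>4) * (phi24 i\<^sub>1 * phi24 i\<^sub>2 * phi24 i\<^sub>3)
       + of_bool (i\<^sub>1 = i\<^sub>3) * (phi24 i\<^sub>1 * phi24 i\<^sub>2 * phi24 i\<^sub>4)" (is "?sum = ?rhs")
    if F: "frame i\<^sub>1 i\<^sub>2 i\<^sub>3 i\<^sub>4" for i\<^sub>1 i\<^sub>2 i\<^sub>3 i\<^sub>4
  proof -
    have inv: "inverse (phi24 k) = val (zpsi k) / 2" if "k \<in> set (apexes i\<^sub>1 i\<^sub>2 i\<^sub>3 i\<^sub>4)" for k
      using that succs_verts[of k i\<^sub>2] by (intro phi24_inverse) (auto simp: apexes_def third_def)
    have id: "if i\<^sub>1 = i\<^sub>3 \<or> i\<^sub>2 = i\<^sub>4 then degenerate_identity (i\<^sub>1, i\<^sub>2, i\<^sub>3, i\<^sub>4) else octahedral_identity (i\<^sub>1, i\<^sub>2, i\<^sub>3, i\<^sub>4)"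
      using frame_identities frames[OF F] by (auto simp: list_all_iff)
    show ?thesis
    proof (cases "i\<^sub>1 = i\<^sub>3 \<or> i\<^sub>2 = i\<^sub>4")
      case True
      \<comment> \<open>The first pair of equal cells contains the one at \<open>(i\<^sub>1, i\<^sub>2, k)\<close>; this is the second pair.\<close>
      define z where "z k = (if i\<^sub>1 = i\<^sub>3 then rotated zcell24 i\<^sub>1 i\<^sub>4 k else rotated zcell24 i\<^sub>3 i\<^sub>2 k)" for k
      have "inverse (phi24 k) * r i\<^sub>1 i\<^sub>2 k * r i\<^sub>3 i\<^sub>2 k * r i\<^sub>3 i\<^sub>4 k * r i\<^sub>1 i\<^sub>4 k
         = (\<tau> + 2) / 2 * val (zprod [zpsi k, rotated zcell24 i\<^sub>1 i\<^sub>2 k, z k])"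
        if "k \<in> set (apexes i\<^sub>1 i\<^sub>2 i\<^sub>3 i\<^sub>4)" for k
      proof -
        have "r i\<^sub>1 i\<^sub>2 k * r i\<^sub>3 i\<^sub>2 k * (r i\<^sub>3 i\<^sub>4 k * r i\<^sub>1 i\<^sub>4 k) =
          (r i\<^sub>1 i\<^sub>2 k * r i\<^sub>1 i\<^sub>2 k) * (if i\<^sub>1 = i\<^sub>3 then r i\<^sub>1 i\<^sub>4 k * r i\<^sub>1 i\<^sub>4 k else r i\<^sub>3 i\<^sub>2 k * r i\<^sub>3 i\<^sub>2 k)"
          using True by (auto simp: mult_ac)
        also have "\<dots> = (\<lbrakk>2\<rbrakk>\<^sub>q * \<lbrakk>2\<rbrakk>\<^sub>q) * (val (rotated zcell24 i\<^sub>1 i\<^sub>2 k) * val (z k))"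
          unfolding r2 z_def by simp
        finally show ?thesis unfolding x2 by (simp add: inv[OF that] val_zprod mult.assoc)
      qed
      then have "?sum = (\<Sum>k\<leftarrow>apexes i\<^sub>1 i\<^sub>2 i\<^sub>3 i\<^sub>4. (\<tau> + 2) / 2 * val (zprod [zpsi k, rotated zcell24 i\<^sub>1 i\<^sub>2 k, z k]))"
        by (intro arg_cong[where f = sum_list] map_cong) auto
      also have "\<dots> = val (zmul (Z 2 1 0 0) (zsum (map (\<lambda>k. zprod [zpsi k, rotated zcell24 i\<^sub>1 i\<^sub>2 k, z k]) (apexes i\<^sub>1 i\<^sub>2 i\<^sub>3 i\<^sub>4)))) / 2"
        unfolding sum_list_const_mult by (simp add: val_zmul val_zsum o_def)
      also have "\<dots> = ?rhs" using True id
        by (auto simp: degenerate_identity_def z_def[abs_def] val_zprod val_zadd phi24_val algebra_simps)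
      finally show ?thesis .
    next
      case False
      then obtain k l where kl: "apexes i\<^sub>1 i\<^sub>2 i\<^sub>3 i\<^sub>4 = [k, l]"
        using id by (auto simp: octahedral_identity_def split: list.splits)
      define A where "A k = inverse (phi24 k) * r i\<^sub>1 i\<^sub>2 k * r i\<^sub>3 i\<^sub>2 k * r i\<^sub>3 i\<^sub>4 k * r i\<^sub>1 i\<^sub>4 k" for k
      have A2: "(A k)\<^sup>2 = (\<tau> + 2)\<^sup>2 / 4 * val (zprod [zpsi k, zpsi k, rotated zcell24 i\<^sub>1 i\<^sub>2 k, rotated zcell24 i\<^sub>3 i\<^sub>2 k, rotated zcell24 i\<^sub>3 i\<^sub>4 k, rotated zcell24 i\<^sub>1 i\<^sub>4 k])"
        and sgn: "sgn (A k) = of_int (rotated cell_sign i\<^sub>1 i\<^sub>2 k * rotated cell_sign i\<^sub>3 i\<^sub>2 k * rotated cell_sign i\<^sub>3 i\<^sub>4 k * rotated cell_sign i\<^sub>1 i\<^sub>4 k)"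
        if k: "k \<in> set (apexes i\<^sub>1 i\<^sub>2 i\<^sub>3 i\<^sub>4)" for k
      proof -
        have "(A k)\<^sup>2 = (inverse (phi24 k) * inverse (phi24 k)) * (r i\<^sub>1 i\<^sub>2 k * r i\<^sub>1 i\<^sub>2 k) * (r i\<^sub>3 i\<^sub>2 k * r i\<^sub>3 i\<^sub>2 k) * (r i\<^sub>3 i\<^sub>4 k * r i\<^sub>3 i\<^sub>4 k) * (r i\<^sub>1 i\<^sub>4 k * r i\<^sub>1 i\<^sub>4 k)"
          by (simp add: A_def power2_eq_square)
        also have "\<dots> = (\<lbrakk>2\<rbrakk>\<^sub>q * \<lbrakk>2\<rbrakk>\<^sub>q)\<^sup>2 / 4 * val (zprod [zpsi k, zpsi k, rotated zcell24 i\<^sub>1 i\<^sub>2 k, rotated zcell24 i\<^sub>3 i\<^sub>2 k, rotated zcell24 i\<^sub>3 i\<^sub>4 k, rotated zcell24 i\<^sub>1 i\<^sub>4 k])"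
          unfolding r2 inv[OF k] by (simp add: val_zprod power2_eq_square)
        finally show "(A k)\<^sup>2 = (\<tau> + 2)\<^sup>2 / 4 * val (zprod [zpsi k, zpsi k, rotated zcell24 i\<^sub>1 i\<^sub>2 k, rotated zcell24 i\<^sub>3 i\<^sub>2 k, rotated zcell24 i\<^sub>3 i\<^sub>4 k, rotated zcell24 i\<^sub>1 i\<^sub>4 k])"
          unfolding x2 .
        have "phi24 k > 0" using perron_frobenius_E24 k succs_verts[of k i\<^sub>2]
          by (auto simp: perron_frobenius_eigenvector_def apexes_def third_def)
        then show "sgn (A k) = of_int (rotated cell_sign i\<^sub>1 i\<^sub>2 k * rotated cell_sign i\<^sub>3 i\<^sub>2 k * rotated cell_sign i\<^sub>3 i\<^sub>4 k * rotated cell_sign i\<^sub>1 i\<^sub>4 k)"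
          using F k unfolding A_def r_def by (simp add: sgn_mult frame_def apexes_def sgn_rotated_cell24)
      qed
      have "A k + A l = 0"
      proof (rule squares_opposite_signs)
        have o: "octahedral_identity (i\<^sub>1, i\<^sub>2, i\<^sub>3, i\<^sub>4)" using id False by simp
        show "(A k)\<^sup>2 = (A l)\<^sup>2" using o by (simp add: A2 kl octahedral_identity_def)
        have "sgn (A k) = of_int (- (rotated cell_sign i\<^sub>1 i\<^sub>2 l * rotated cell_sign i\<^sub>3 i\<^sub>2 l * rotated cell_sign i\<^sub>3 i\<^sub>4 l * rotated cell_sign i\<^sub>1 i\<^sub>4 l))"
          using o unfolding octahedral_identity_def kl by (subst sgn) (simp_all add: kl)
        also have "\<dots> = - sgn (A l)" using sgn[of l] kl by simp
        finally show "sgn (A k) = - sgn (A l)" .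
      qed
      then show ?thesis using False by (simp add: kl A_def)
    qed
  qed
  from this[THEN arg_cong[where f = complex_of_real]] show ?thesis
    unfolding type_II_E24 on_cell_W24 r_def by (simp add: of_real_sum_list o_def)
qed

lemma cell_system_W24: "cell_system E24 phi24 W24"
  by (simp add: cell_system_def fin_digraph_E24 perron_frobenius_E24 rotation_invariant_W24 type_I_W24 type_II_W24)

section \<open>Peeling triangles off a complex\<close>

text \<open>The triangles of the first list can be removed one after another from the complex formed by both
  lists, where each is removed through an edge that lies in no other triangle that is still present.\<close>

fun peels :: "(nat \<times> nat \<times> nat) list \<Rightarrow> (nat \<times> nat \<times> nat) list \<Rightarrow> bool" where
  "peels [] C \<longleftrightarrow> True"
| "peels (t # ts) C \<longleftrightarrow>
     list_ex (\<lambda>e. list_all (\<lambda>s. e \<notin> set (edges s)) (ts @ C)) (edges t) \<and> peels ts C"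

lemma peels_append: "peels ts (ts' @ C) \<Longrightarrow> peels ts' C \<Longrightarrow> peels (ts @ ts') C"
  by (induction ts) auto

lemma peels_remaining: "peels ts (C @ S @ C') \<Longrightarrow> peels ts (C @ C')"
  by (induction ts) (auto simp: list_ex_iff list_all_iff)

text \<open>A 2-cycle vanishes on a triangle that has a free edge, because it is the only summand in the cycle
  condition at this edge; then it is a 2-cycle on the remaining complex.\<close>

lemma cycle_vanishes_on_peeled:
  fixes D :: "nat \<times> nat \<times> nat \<Rightarrow> 'a::ab_group_add"
  assumes "peels ts C"
    and "\<And>t e. t \<in> set ts \<Longrightarrow> e \<in> set (edges t) \<Longrightarrow> (\<Sum>s\<leftarrow>filter (\<lambda>s. e \<in> set (edges s)) (ts @ C). D s) = 0"
  shows "\<forall>t\<in>set ts. D t = 0"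
  using assms
proof (induction ts)
  case (Cons t ts)
  from Cons.prems(1) obtain e where e: "e \<in> set (edges t)" "\<forall>s\<in>set (ts @ C). e \<notin> set (edges s)"
    by (auto simp: list_ex_iff list_all_iff)
  then have "filter (\<lambda>s. e \<in> set (edges s)) ((t # ts) @ C) = [t]"
    by (auto simp: filter_empty_conv)
  then have "D t = 0" using Cons.prems(2)[of t e] e(1) by (simp del: edges.simps)
  moreover have "\<forall>s\<in>set ts. D s = 0"
  proof (rule Cons.IH)
    show "peels ts C" using Cons.prems(1) by simp
    fix s e assume "s \<in> set ts" "e \<in> set (edges s)"
    then show "(\<Sum>s\<leftarrow>filter (\<lambda>s. e \<in> set (edges s)) (ts @ C). D s) = 0"
      using Cons.prems(2)[of s e] \<open>D t = 0\<close> by (simp del: edges.simps split: if_splits)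
  qed
  ultimately show ?case by simp
qed simp

lemma prod_list_scale_one:
  fixes u :: "'e \<Rightarrow> 'a::comm_monoid_mult"
  shows "distinct es \<Longrightarrow> (\<Prod>x\<leftarrow>es. (u(e := u e * c)) x) = (if e \<in> set es then c else 1) * (\<Prod>x\<leftarrow>es. u x)"
  by (induction es) (auto simp: mult_ac)

text \<open>Prescribed phases on a complex that can be peeled off completely are products of phases of edges. Induction
  adds the triangles in reverse order: changing the phase of the free edge of the new triangle does not
  affect the earlier ones.\<close>

lemma gauge_on_peelable:
  fixes r :: "nat \<times> nat \<times> nat \<Rightarrow> complex"
  assumes "peels ts []" and "\<And>t. t \<in> set ts \<Longrightarrow> cmod (r t) = 1"
    and "\<And>t. t \<in> set ts \<Longrightarrow> distinct (edges t)"
  shows "\<exists>u. (\<forall>e. cmod (u e) = 1) \<and> (\<forall>t\<in>set ts. r t = (\<Prod>e\<leftarrow>edges t. u e))"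
  using assms
proof (induction ts)
  case (Cons t ts)
  then obtain u where u: "\<forall>e. cmod (u e) = 1" "\<forall>s\<in>set ts. r s = (\<Prod>e\<leftarrow>edges s. u e)"
    by auto
  from Cons.prems(1) obtain e where e: "e \<in> set (edges t)" "\<forall>s\<in>set ts. e \<notin> set (edges s)"
    by (auto simp: list_ex_iff list_all_iff)
  define p where "p = (\<Prod>e\<leftarrow>edges t. u e)"
  have "cmod p = 1" unfolding p_def by (cases t) (simp add: norm_mult u(1))
  then have p: "p \<noteq> 0" by auto
  define c where "c = r t / p"
  let ?u = "u(e := u e * c)"
  have "\<forall>e. cmod (?u e) = 1"
    using u(1) \<open>cmod p = 1\<close> Cons.prems(2)[of t] by (simp add: c_def norm_mult norm_divide del: split_paired_All)
  moreover have "r s = (\<Prod>e\<leftarrow>edges s. ?u e)" if "s \<in> set (t # ts)" for s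
  proof (cases "s = t")
    case True
    then have "(\<Prod>e\<leftarrow>edges s. ?u e) = c * p" using e(1) Cons.prems(3)[of t]
      by (simp del: edges.simps fun_upd_apply add: prod_list_scale_one flip: p_def)
    then show ?thesis using p True by (simp add: c_def)
  next
    case False
    then show ?thesis using e(2) u(2) that Cons.prems(3)[of s]
      by (simp del: edges.simps fun_upd_apply add: prod_list_scale_one)
  qed
  ultimately show ?case by blast
qed (auto intro: exI[of _ "\<lambda>_. 1"])

section \<open>Consequences of condition (II)\<close>

lemma on_cell_rotate:
  assumes "rotation_invariant E24 W" "j \<in> set (succs i)" "k \<in> set (third i j)"
  shows "on_cell W i j k = rotated (on_cell W) i j k"
proof -
  have rot: "on_cell W i j k = on_cell W j k i"
    if "j \<in> set (succs i)" "k \<in> set (succs j)" "i \<in> set (succs k)" for i j k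
    using assms(1)[unfolded rotation_invariant_def, rule_format, of "(i, j)" "(j, k)" "(k, i)"] that
    by (simp add: on_cell_def triangle_def arcs_E24)
  show ?thesis using rot[of j i k] rot[of k j i] assms(2,3) by (simp add: rotated_def third_def)
qed

text \<open>In a degenerate instance of (II) with only one summand, this summand is up to a constant the product of
  the squared moduli on two triangles with a common edge. So the modulus on one of them determines the other.\<close>

lemma modulus_shared_apex:
  assumes W: "type_II E24 phi24 W" and W': "type_II E24 phi24 W'"
    and F: "frame i\<^sub>1 i\<^sub>2 i\<^sub>3 i\<^sub>4" "i\<^sub>1 = i\<^sub>3 \<or> i\<^sub>2 = i\<^sub>4" "apexes i\<^sub>1 i\<^sub>2 i\<^sub>3 i\<^sub>4 = [k]"
    and known: "cmod (on_cell W i\<^sub>1 i\<^sub>2 k) = cmod (on_cell W' i\<^sub>1 i\<^sub>2 k)" "on_cell W' i\<^sub>1 i\<^sub>2 k \<noteq> 0"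
  shows "cmod (on_cell W i\<^sub>3 i\<^sub>4 k) = cmod (on_cell W' i\<^sub>3 i\<^sub>4 k)"
proof -
  have k: "phi24 k > 0" using F(3) perron_frobenius_E24 succs_verts[of k i\<^sub>2]
    by (auto simp: perron_frobenius_eigenvector_def apexes_def third_def filter_eq_Cons_iff)
  have "of_real (inverse (phi24 k)) * on_cell W i\<^sub>1 i\<^sub>2 k * cnj (on_cell W i\<^sub>3 i\<^sub>2 k) * on_cell W i\<^sub>3 i\<^sub>4 k * cnj (on_cell W i\<^sub>1 i\<^sub>4 k)
     = of_real (inverse (phi24 k)) * on_cell W' i\<^sub>1 i\<^sub>2 k * cnj (on_cell W' i\<^sub>3 i\<^sub>2 k) * on_cell W' i\<^sub>3 i\<^sub>4 k * cnj (on_cell W' i\<^sub>1 i\<^sub>4 k)"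
    using W[unfolded type_II_E24, rule_format, of i\<^sub>1 i\<^sub>2 i\<^sub>3 i\<^sub>4]
      W'[unfolded type_II_E24, rule_format, of i\<^sub>1 i\<^sub>2 i\<^sub>3 i\<^sub>4] F
    by simp
  from this[THEN arg_cong[where f = cmod]] k known F(2)
  have "(cmod (on_cell W i\<^sub>3 i\<^sub>4 k))\<^sup>2 = (cmod (on_cell W' i\<^sub>3 i\<^sub>4 k))\<^sup>2"
    by (auto simp: norm_mult power2_eq_square)
  then show ?thesis by (rule power2_eq_imp_eq) auto
qed

text \<open>Condition (II) for a non-degenerate 4-cycle with apexes \<open>k\<close> and \<open>l\<close> relates the eight faces of an
  octahedron. Both of its summands are multiplied by the same phase when a gauge transformation is applied,
  since the phases of the edges at \<open>k\<close> and \<open>l\<close> cancel. Hence the gauge transform of \<open>W'\<close> satisfies the same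
  linear equation for the face \<open>(i\<^sub>1, i\<^sub>2, k)\<close> as \<open>W\<close>, and its coefficient is non-zero.\<close>

lemma gauge_through_octahedron:
  assumes W: "type_II E24 phi24 W" and W': "type_II E24 phi24 W'"
    and F: "frame i\<^sub>1 i\<^sub>2 i\<^sub>3 i\<^sub>4" "i\<^sub>1 \<noteq> i\<^sub>3" "i\<^sub>2 \<noteq> i\<^sub>4" "apexes i\<^sub>1 i\<^sub>2 i\<^sub>3 i\<^sub>4 = [k, l]"
    and u: "\<And>e. cmod (u e) = 1"
    and known: "\<And>i j m. (i, j, m) \<in> {(i\<^sub>3, i\<^sub>2, k), (i\<^sub>3, i\<^sub>4, k), (i\<^sub>1, i\<^sub>4, k),
          (i\<^sub>1, i\<^sub>2, l), (i\<^sub>3, i\<^sub>2, l), (i\<^sub>3, i\<^sub>4, l), (i\<^sub>1, i\<^sub>4, l)} \<Longrightarrow>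
        on_cell W i j m = u (i, j) * u (j, m) * u (m, i) * on_cell W' i j m \<and> on_cell W' i j m \<noteq> 0"
  shows "on_cell W i\<^sub>1 i\<^sub>2 k = u (i\<^sub>1, i\<^sub>2) * u (i\<^sub>2, k) * u (k, i\<^sub>1) * on_cell W' i\<^sub>1 i\<^sub>2 k"
proof -
  have uu: "u e * cnj (u e) = 1" for e using u by (simp flip: complex_norm_square)
  define U where "U i j m = u (i, j) * u (j, m) * u (m, i) * on_cell W' i j m" for i j m
  define A where "A V m = of_real (inverse (phi24 m)) * V i\<^sub>1 i\<^sub>2 m * cnj (V i\<^sub>3 i\<^sub>2 m) * V i\<^sub>3 i\<^sub>4 m * cnj (V i\<^sub>1 i\<^sub>4 m)"
    for m and V :: "nat \<Rightarrow> nat \<Rightarrow> nat \<Rightarrow> complex"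
  have "A (on_cell W) k + A (on_cell W) l = 0"
    using W[unfolded type_II_E24, rule_format, of i\<^sub>1 i\<^sub>2 i\<^sub>3 i\<^sub>4] F by (simp add: A_def)
  moreover have "A (on_cell W') k + A (on_cell W') l = 0"
    using W'[unfolded type_II_E24, rule_format, of i\<^sub>1 i\<^sub>2 i\<^sub>3 i\<^sub>4] F by (simp add: A_def)
  moreover have "A U m = u (i\<^sub>1, i\<^sub>2) * cnj (u (i\<^sub>3, i\<^sub>2)) * u (i\<^sub>3, i\<^sub>4) * cnj (u (i\<^sub>1, i\<^sub>4)) * A (on_cell W') m" for m
  proof -
    have "A U m = u (i\<^sub>1, i\<^sub>2) * cnj (u (i\<^sub>3, i\<^sub>2)) * u (i\<^sub>3, i\<^sub>4) * cnj (u (i\<^sub>1, i\<^sub>4)) * A (on_cell W') m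
      * (u (i\<^sub>2, m) * cnj (u (i\<^sub>2, m))) * (u (m, i\<^sub>1) * cnj (u (m, i\<^sub>1)))
      * (u (m, i\<^sub>3) * cnj (u (m, i\<^sub>3))) * (u (i\<^sub>4, m) * cnj (u (i\<^sub>4, m)))"
      unfolding A_def U_def by (simp add: mult_ac)
    then show ?thesis by (simp add: uu)
  qed
  then have "A U k + A U l = u (i\<^sub>1, i\<^sub>2) * cnj (u (i\<^sub>3, i\<^sub>2)) * u (i\<^sub>3, i\<^sub>4) * cnj (u (i\<^sub>1, i\<^sub>4)) *
      (A (on_cell W') k + A (on_cell W') l)"
    by (simp add: distrib_left)
  moreover have "A U l = A (on_cell W) l" using known by (simp add: A_def U_def)
  ultimately have "A U k = A (on_cell W) k" by (simp add: add_eq_0_iff2)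
  moreover have "phi24 k > 0" using F(4) perron_frobenius_E24 succs_verts[of k i\<^sub>2]
    by (auto simp: perron_frobenius_eigenvector_def apexes_def third_def filter_eq_Cons_iff)
  moreover have "u e \<noteq> 0" for e using u[of e] by auto
  ultimately show ?thesis using known by (simp add: A_def U_def)
qed

section \<open>Uniqueness\<close>

definition cell_of :: "(nat \<times> nat \<Rightarrow> nat \<times> nat \<Rightarrow> nat \<times> nat \<Rightarrow> 'a) \<Rightarrow> nat \<times> nat \<times> nat \<Rightarrow> 'a" where
  "cell_of W = (\<lambda>(a, b, c). on_cell W a b c)"

lemma peels_E24: "peels collar (seeds @ punctured)" "peels punctured []"
  by code_simp+

lemma distinct_edges: "t \<in> set triangles \<Longrightarrow> distinct (edges t)"
proof -
  have "list_all (\<lambda>t. distinct (edges t)) triangles" by code_simp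
  then show "t \<in> set triangles \<Longrightarrow> distinct (edges t)" by (simp add: list_all_iff)
qed

text \<open>The list of all triangles and the adjacency lists agree on the triangles through an edge, each of which
  occurs once in either of them.\<close>

definition edge_in_listed_triangles :: "nat \<Rightarrow> nat \<Rightarrow> bool" where
  "edge_in_listed_triangles i j \<longleftrightarrow> j \<in> set (succs i) \<and>
     (let xs = filter (\<lambda>s. (i, j) \<in> set (edges s)) triangles;
          ys = map (rotated (\<lambda>a b c. (a, b, c)) i j) (third i j)
      in distinct xs \<and> distinct ys \<and> set xs = set ys)"

lemma triangles_on_edge:
  fixes D :: "nat \<Rightarrow> nat \<Rightarrow> nat \<Rightarrow> 'a::comm_monoid_add"
  assumes "t \<in> set triangles" "(i, j) \<in> set (edges t)"
  shows "j \<in> set (succs i)"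
    and "(\<Sum>s\<leftarrow>filter (\<lambda>s. (i, j) \<in> set (edges s)) triangles. case s of (a, b, c) \<Rightarrow> D a b c)
       = (\<Sum>k\<leftarrow>third i j. rotated D i j k)"
proof -
  have "list_all (\<lambda>t. list_all (\<lambda>(i, j). edge_in_listed_triangles i j) (edges t)) triangles"
    by code_simp
  then have "edge_in_listed_triangles i j"
    using assms by (auto simp: list_all_iff simp del: edges.simps)
  then have *: "j \<in> set (succs i)"
     "distinct (filter (\<lambda>s. (i, j) \<in> set (edges s)) triangles)"
     "distinct (map (rotated (\<lambda>a b c. (a, b, c)) i j) (third i j))"
     "set (filter (\<lambda>s. (i, j) \<in> set (edges s)) triangles) = set (map (rotated (\<lambda>a b c. (a, b, c)) i j) (third i j))"
    unfolding edge_in_listed_triangles_def Let_def by blast+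
  show "j \<in> set (succs i)" by (rule *)
  let ?D = "\<lambda>s. case s of (a, b, c) \<Rightarrow> D a b c"
  have "(\<Sum>s\<leftarrow>filter (\<lambda>s. (i, j) \<in> set (edges s)) triangles. ?D s)
    = (\<Sum>s\<leftarrow>map (rotated (\<lambda>a b c. (a, b, c)) i j) (third i j). ?D s)"
    unfolding sum_list_distinct_conv_sum_set[OF *(2)] sum_list_distinct_conv_sum_set[OF *(3)] *(4) ..
  also have "\<dots> = (\<Sum>k\<leftarrow>third i j. rotated D i j k)"
    unfolding map_map by (intro arg_cong[where f = sum_list] map_cong) (auto simp: rotated_def)
  finally show "(\<Sum>s\<leftarrow>filter (\<lambda>s. (i, j) \<in> set (edges s)) triangles. ?D s) = (\<Sum>k\<leftarrow>third i j. rotated D i j k)" .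
qed

lemma cell_of_W24_nonzero: "t \<in> set triangles \<Longrightarrow> cell_of W24 t \<noteq> 0"
proof -
  assume t: "t \<in> set triangles"
  obtain a b c where abc: "t = (a, b, c)" by (cases t)
  have "list_all (\<lambda>(a, b, c). a \<le> 8) triangles" by code_simp
  then have "a \<le> 8" using t abc by (auto simp: list_all_iff)
  moreover have "cell24 a b c \<noteq> 0" using sgn_cell24[of a b c] t abc by (auto simp: cell_sign_def split: if_splits)
  ultimately show ?thesis by (simp add: cell_of_def abc on_cell_W24 rotated_def)
qed

lemma on_cell_W24_nonzero:
  assumes "j \<in> set (succs i)" "k \<in> set (third i j)" shows "on_cell W24 i j k \<noteq> 0"
  using sgn_rotated_cell24[OF assms] by (auto simp: on_cell_W24 rotated_def cell_sign_def split: if_splits)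

text \<open>The difference \<open>D\<close> of squared moduli is a 2-cycle by condition (I). It vanishes on \<open>collar\<close> by peeling,
  then on \<open>seeds\<close> by \<open>modulus_shared_apex\<close>, and then on \<open>punctured\<close> by peeling again.\<close>

lemma unique_moduli:
  assumes W: "cell_system E24 phi24 W" and t: "t \<in> set triangles"
  shows "cmod (cell_of W t) = cmod (cell_of W24 t)"
proof -
  define D where "D a b c = on_cell W a b c * cnj (on_cell W a b c) - on_cell W24 a b c * cnj (on_cell W24 a b c)" for a b c
  let ?D = "\<lambda>s. case s of (a, b, c) \<Rightarrow> D a b c"
  have D: "cmod (on_cell W a b c) = cmod (on_cell W24 a b c) \<longleftrightarrow> D a b c = 0" for a b c
    unfolding D_def complex_norm_square[symmetric] right_minus_eq
    by (metis norm_ge_zero of_real_eq_iff power2_eq_imp_eq of_real_power)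
  have inv: "rotation_invariant E24 W" and I: "type_I E24 phi24 W" and II: "type_II E24 phi24 W"
    using W by (auto simp: cell_system_def)
  have rot: "D i j k = rotated D i j k" if "j \<in> set (succs i)" "k \<in> set (third i j)" for i j k
    using on_cell_rotate[OF inv that] on_cell_rotate[OF rotation_invariant_W24 that]
    by (auto simp: D_def rotated_def)
  have cycle: "(\<Sum>s\<leftarrow>filter (\<lambda>s. e \<in> set (edges s)) triangles. ?D s) = 0"
    if "s \<in> set triangles" "e \<in> set (edges s)" for s e
  proof -
    obtain i j where e: "e = (i, j)" by (cases e)
    note j = triangles_on_edge(1)[OF that[unfolded e]]
    have "(\<Sum>s\<leftarrow>filter (\<lambda>s. e \<in> set (edges s)) triangles. ?D s) = (\<Sum>k\<leftarrow>third i j. rotated D i j k)"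
      unfolding e by (rule triangles_on_edge(2)[OF that[unfolded e]])
    also have "\<dots> = (\<Sum>k\<leftarrow>third i j. D i j k)"
      using rot[OF j] by (intro arg_cong[where f = sum_list] map_cong) auto
    also have "\<dots> = 0"
      using I[unfolded type_I_E24, rule_format, OF j] type_I_W24[unfolded type_I_E24, rule_format, OF j]
      by (simp add: D_def sum_list_subtractf)
    finally show ?thesis .
  qed
  have collar: "\<forall>t\<in>set collar. ?D t = 0"
  proof (rule cycle_vanishes_on_peeled[OF peels_E24(1)])
    fix t e assume "t \<in> set collar" "e \<in> set (edges t)"
    then show "(\<Sum>s\<leftarrow>filter (\<lambda>s. e \<in> set (edges s)) (collar @ seeds @ punctured). ?D s) = 0"
      using cycle[of t e] by (simp add: triangles_def del: edges.simps)
  qed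
  have known: "cmod (on_cell W a b c) = cmod (on_cell W24 a b c)" if "(a, b, c) \<in> set collar" for a b c
    using collar that D by auto
  note shared = modulus_shared_apex[OF II type_II_W24]
  have s1: "D 3 12 19 = 0"
  proof -
    have a: "frame 3 10 3 12" "apexes 3 10 3 12 = [19]" by code_simp+
    show ?thesis using shared[OF a(1) _ a(2)] known[of 3 10 19] on_cell_W24_nonzero[of 10 3 19]
      by (simp add: collar_def third_def succs_def flip: D)
  qed
  have s2: "D 4 11 19 = 0"
  proof -
    have a: "frame 2 11 4 11" "apexes 2 11 4 11 = [19]" by code_simp+
    show ?thesis using shared[OF a(1) _ a(2)] known[of 2 11 19] on_cell_W24_nonzero[of 11 2 19]
      by (simp add: collar_def third_def succs_def flip: D)
  qed
  have s3: "D 6 11 20 = 0"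
  proof -
    \<comment> \<open>The common edge has to end at the apex, so both triangles are rotated to have apex \<open>11\<close>.\<close>
    have a: "frame 18 6 20 6" "apexes 18 6 20 6 = [11]" by code_simp+
    have "D 18 6 11 = D 6 11 18" "D 20 6 11 = D 6 11 20" using rot[of 6 18 11] rot[of 6 20 11]
      by (simp_all add: rotated_def third_def succs_def)
    then show ?thesis using shared[OF a(1) _ a(2)] known[of 6 11 18] on_cell_W24_nonzero[of 6 18 11]
      by (simp add: collar_def third_def succs_def D)
  qed
  have rest: "\<forall>t\<in>set (collar @ seeds). ?D t = 0" using collar s1 s2 s3 by (auto simp: seeds_def)
  have "\<forall>t\<in>set punctured. ?D t = 0"
  proof (rule cycle_vanishes_on_peeled[OF peels_E24(2)])
    fix t e assume te: "t \<in> set punctured" "e \<in> set (edges t)"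
    have zero: "(\<Sum>s\<leftarrow>xs. ?D s) = 0" if "\<forall>s\<in>set xs. ?D s = 0" for xs
      using that by (induction xs) auto
    have zero': "(\<Sum>s\<leftarrow>filter P (collar @ seeds). ?D s) = 0" for P
    proof (rule zero, rule ballI)
      fix s assume "s \<in> set (filter P (collar @ seeds))"
      then have "s \<in> set (collar @ seeds)" by auto
      then show "?D s = 0" by (rule bspec[OF rest])
    qed
    show "(\<Sum>s\<leftarrow>filter (\<lambda>s. e \<in> set (edges s)) (punctured @ []). ?D s) = 0"
      using cycle[of t e] te zero'[of "\<lambda>s. e \<in> set (edges s)"]
      by (simp add: triangles_def del: edges.simps flip: add.assoc)
  qed
  then have "?D t = 0" using rest t unfolding triangles_def set_append by blast
  then show ?thesis using D by (cases t) (simp add: cell_of_def)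
qed

text \<open>Without the seeds the complex peels off completely, which gives the gauge transformation \<open>u\<close>. Each seed is
  a face of only one octahedron, so \<open>gauge_through_octahedron\<close> applies to the seeds independently.\<close>

lemma unique_up_to_gauge:
  assumes W: "cell_system E24 phi24 W"
  obtains u where "\<And>e. cmod (u e) = 1"
    and "\<And>i j k. j \<in> set (succs i) \<Longrightarrow> k \<in> set (third i j) \<Longrightarrow>
        on_cell W i j k = u (i, j) * u (j, k) * u (k, i) * on_cell W24 i j k"
proof -
  define r where "r t = cell_of W t / cell_of W24 t" for t
  have inv: "rotation_invariant E24 W" and II: "type_II E24 phi24 W"
    using W by (auto simp: cell_system_def)
  have "peels (collar @ punctured) []"
    using peels_E24 peels_remaining[of collar "[]" seeds punctured] by (intro peels_append) auto
  moreover have "cmod (r t) = 1" if "t \<in> set triangles" for t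
    using unique_moduli[OF W that] cell_of_W24_nonzero[OF that] by (simp add: r_def norm_divide)
  ultimately have "\<exists>u. (\<forall>e. cmod (u e) = 1) \<and> (\<forall>t\<in>set (collar @ punctured). r t = (\<Prod>e\<leftarrow>edges t. u e))"
    by (intro gauge_on_peelable distinct_edges) (simp_all add: triangles_def del: split_paired_All edges.simps, blast+)
  then obtain u where u: "\<And>e. cmod (u e) = 1"
    and ru: "\<And>t. t \<in> set (collar @ punctured) \<Longrightarrow> r t = (\<Prod>e\<leftarrow>edges t. u e)"
    by blast
  define good where "good i j k \<longleftrightarrow> on_cell W i j k = u (i, j) * u (j, k) * u (k, i) * on_cell W24 i j k" for i j k
  have peeled: "good a b c" if "(a, b, c) \<in> set (collar @ punctured)" for a b c
    using ru[OF that] cell_of_W24_nonzero[of "(a, b, c)"] that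
    by (auto simp: r_def good_def cell_of_def triangles_def field_simps)
  note octahedron = gauge_through_octahedron[OF II type_II_W24 _ _ _ _ u]
  have s: "good i\<^sub>1 i\<^sub>2 k" if a: "frame i\<^sub>1 i\<^sub>2 i\<^sub>3 i\<^sub>4" "i\<^sub>1 \<noteq> i\<^sub>3" "i\<^sub>2 \<noteq> i\<^sub>4" "apexes i\<^sub>1 i\<^sub>2 i\<^sub>3 i\<^sub>4 = [k, l]"
    and b: "set [(i\<^sub>3, i\<^sub>2, k), (i\<^sub>3, i\<^sub>4, k), (i\<^sub>1, i\<^sub>4, k), (i\<^sub>1, i\<^sub>2, l), (i\<^sub>3, i\<^sub>2, l), (i\<^sub>3, i\<^sub>4, l), (i\<^sub>1, i\<^sub>4, l)] \<subseteq> set (collar @ punctured)"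
    for i\<^sub>1 i\<^sub>2 i\<^sub>3 i\<^sub>4 k l
    unfolding good_def
  proof (rule octahedron[OF a])
    fix i j m assume "(i, j, m) \<in> {(i\<^sub>3, i\<^sub>2, k), (i\<^sub>3, i\<^sub>4, k), (i\<^sub>1, i\<^sub>4, k), (i\<^sub>1, i\<^sub>2, l), (i\<^sub>3, i\<^sub>2, l), (i\<^sub>3, i\<^sub>4, l), (i\<^sub>1, i\<^sub>4, l)}"
    then have "(i, j, m) \<in> set (collar @ punctured)" using b by auto
    then show "on_cell W i j m = u (i, j) * u (j, m) * u (m, i) * on_cell W24 i j m \<and> on_cell W24 i j m \<noteq> 0"
      using peeled[of i j m] cell_of_W24_nonzero[of "(i, j, m)"] by (auto simp: good_def cell_of_def triangles_def)
  qed
  have "good 3 12 19" by (rule s[of 3 12 4 14 19 21]) code_simp+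
  moreover have "good 4 11 19" by (rule s[of 4 11 5 14 19 22]) code_simp+
  moreover have "good 6 11 20" by (rule s[of 6 11 5 13 20 22]) code_simp+
  ultimately have good: "good a b c" if "(a, b, c) \<in> set triangles" for a b c
    using peeled that by (auto simp: triangles_def seeds_def)
  show ?thesis
  proof
    show "cmod (u e) = 1" for e by (rule u)
    fix i j k assume jk: "j \<in> set (succs i)" "k \<in> set (third i j)"
    show "on_cell W i j k = u (i, j) * u (j, k) * u (k, i) * on_cell W24 i j k"
      unfolding on_cell_rotate[OF inv jk] on_cell_rotate[OF rotation_invariant_W24 jk]
      using rotated_triangle[OF jk] by (auto simp: rotated_def good_def mult_ac dest: good split: if_splits)
  qed
qed

theorem theorem14p1:
  shows "cell_system E24 phi24 W24 \<and>
    (\<forall>W. cell_system E24 phi24 W \<longrightarrow> equivalent_cell_systems E24 W W24)"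
proof (intro conjI allI impI)
  fix W assume W: "cell_system E24 phi24 W"
  obtain u where u: "\<And>e. cmod (u e) = 1"
    and WW: "\<And>i j k. j \<in> set (succs i) \<Longrightarrow> k \<in> set (third i j) \<Longrightarrow>
        on_cell W i j k = u (i, j) * u (j, k) * u (k, i) * on_cell W24 i j k"
    using unique_up_to_gauge[OF W] by blast
  have uu: "u e * cnj (u e) = 1" "cnj (u e) * u e = 1" for e
    using u[of e] complex_norm_square[of "u e"] by (simp_all add: mult.commute)
  show "equivalent_cell_systems E24 W W24"
    unfolding equivalent_cell_systems_def
  proof (intro exI[of _ "\<lambda>i j \<sigma> \<sigma>'. u \<sigma>"] conjI ballI impI)
    show "unitary_on (arcs_between E24 i j) (\<lambda>\<sigma> \<sigma>'. u \<sigma>)" for i j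
      by (simp add: unitary_on_def arcs_between_E24 uu)
    fix i j k \<sigma> \<rho> \<gamma>
    assume "\<sigma> \<in> arcs_between E24 i j" "\<rho> \<in> arcs_between E24 j k" "\<gamma> \<in> arcs_between E24 k i"
    then show "W \<sigma> \<rho> \<gamma> = (\<Sum>\<sigma>'\<in>arcs_between E24 i j. \<Sum>\<rho>'\<in>arcs_between E24 j k. \<Sum>\<gamma>'\<in>arcs_between E24 k i.
                u \<sigma> * u \<rho> * u \<gamma> * W24 \<sigma>' \<rho>' \<gamma>')"
      using WW[of j i k] by (auto simp: arcs_between_E24 on_cell_def third_def split: if_splits)
  qed
qed (rule cell_system_W24)

end
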